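(* Let $r\geq1$ be an integer and let $\mu_{r,r}=R_{1,\frac12}^{\boxtimes r}$ be the $r$-fold free multiplicative convolution power of the arcsine distribution on $[0,1]$. Then the measure $\mu_{r,r}$ is supported on the interval $\left[0,\frac{(r+1)^{r+1}}{2^{r+1}r^r}\right]$ and has the density $$\frac{d\mu_{r,r}}{dx}(x)=\frac{2^{r+2}\sin(\varphi)^2\sin(r\varphi)^{r+1}}{\pi\,\sin((r+1)\varphi)^r\left(4\sin(\varphi)^2\sin(r\varphi)^2+\sin((r-1)\varphi)^2\right)},$$ where the spectral variable $x$ is parameterized by $$x=x(\varphi)=\frac{\sin((r+1)\varphi)^{r+1}}{2^{r+1}\sin(\varphi)\sin(r\varphi)^r},\qquad 0<\varphi<\frac{\pi}{r+1}.$$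
   Context: $R_{1,\frac12}$ denotes the arcsine distribution on $[0,1]$, with density $\frac{1}{\pi\sqrt{x(1-x)}}$ (it is the Raney distribution with moments $\frac{1/2}{k+1/2}\binom{k+1/2}{k}$, $k=0,1,2,\ldots$). The symbol $\boxtimes$ denotes free multiplicative convolution. The measure $\mu_{r,r}$ is the limiting distribution of the squared singular values of products $T_r\cdots T_1$ of $r$ truncated Haar unitary matrices. *)

theory Defs
  imports
    "HOL-Probability.Probability"
    "HOL-Library.Poly_Mapping"
    "HOL-Computational_Algebra.Polynomial"
begin

section \<open>The algebra of noncommutative polynomials\<close>

text \<open>
  The free monoid over \<open>'i\<close>, written additively because the multiplication of
  \<^type>\<open>poly_mapping\<close> convolves along an additive monoid. Thus \<open>'i ncpoly\<close> is
  the free unital complex algebra \<open>\<complex>\<langle>X\<^sub>i | i\<rangle>\<close>.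
\<close>

datatype 'i ncword = Word "'i list"

instantiation ncword :: (type) monoid_add
begin

definition zero_ncword :: "'a ncword" where
  "zero_ncword = Word []"

fun plus_ncword :: "'a ncword \<Rightarrow> 'a ncword \<Rightarrow> 'a ncword" where
  "plus_ncword (Word u) (Word v) = Word (u @ v)"

instance
proof
  fix a b c :: "'a ncword"
  show "a + b + c = a + (b + c)" by (cases a; cases b; cases c) simp
  show "0 + a = a" by (cases a) (simp add: zero_ncword_def)
  show "a + 0 = a" by (cases a) (simp add: zero_ncword_def)
qed

end

type_synonym 'i ncpoly = "'i ncword \<Rightarrow>\<^sub>0 complex"

definition nc_const :: "complex \<Rightarrow> 'i ncpoly" where
  "nc_const c = Poly_Mapping.single 0 c"

definition nc_var :: "'i \<Rightarrow> 'i ncpoly" where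
  "nc_var i = Poly_Mapping.single (Word [i]) 1"

definition nc_eval :: "complex poly \<Rightarrow> 'i ncpoly \<Rightarrow> 'i ncpoly" where
  "nc_eval p a = (\<Sum>k\<le>degree p. nc_const (coeff p k) * a ^ k)"

section \<open>Freeness\<close>

definition unital_functional :: "('i ncpoly \<Rightarrow> complex) \<Rightarrow> bool" where
  "unital_functional \<tau> \<longleftrightarrow>
     \<tau> 1 = 1 \<and> (\<forall>a b. \<tau> (a + b) = \<tau> a + \<tau> b) \<and> (\<forall>c a. \<tau> (nc_const c * a) = c * \<tau> a)"

text \<open>
  The unital subalgebras generated by the single variables are free with respect to \<open>\<tau>\<close>:
  \<open>\<tau> (p\<^sub>1(X\<^bsub>i(1)\<^esub>) \<cdots> p\<^sub>n(X\<^bsub>i(n)\<^esub>)) = 0\<close> whenever \<open>i(j) \<noteq> i(j+1)\<close> and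
  \<open>\<tau> (p\<^sub>j(X\<^bsub>i(j)\<^esub>)) = 0\<close> for all \<open>j\<close>.
\<close>

definition free_variables :: "('i ncpoly \<Rightarrow> complex) \<Rightarrow> bool" where
  "free_variables \<tau> \<longleftrightarrow>
     (\<forall>ps :: ('i \<times> complex poly) list.
        ps \<noteq> [] \<longrightarrow> distinct_adj (map fst ps) \<longrightarrow>
        (\<forall>(i, p) \<in> set ps. \<tau> (nc_eval p (nc_var i)) = 0) \<longrightarrow>
        \<tau> (prod_list (map (\<lambda>(i, p). nc_eval p (nc_var i)) ps)) = 0)"

section \<open>Free multiplicative convolution\<close>

definition moment :: "real measure \<Rightarrow> nat \<Rightarrow> real" where
  "moment \<mu> n = (\<integral>x. x ^ n \<partial>\<mu>)"

definition compact_nonneg_distribution :: "real measure \<Rightarrow> bool" where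
  "compact_nonneg_distribution \<mu> \<longleftrightarrow>
     prob_space \<mu> \<and> sets \<mu> = sets borel \<and> (\<exists>B. AE x in \<mu>. 0 \<le> x \<and> x \<le> B)"

text \<open>
  \<open>\<tau>\<close> is the free product of the distributions \<open>\<mu>\<close> of \<open>X\<close> and \<open>\<nu>\<close> of \<open>Y\<close>.
  The law of the product of the two free variables is given by the moments of \<open>X Y\<close>; since \<open>\<tau>\<close> is
  tracial, these are also the moments of the positive element \<open>X\<^sup>1\<^sup>/\<^sup>2 Y X\<^sup>1\<^sup>/\<^sup>2\<close>. Compactly supported
  measures are determined by their moments, so the description is definite.
  It is meant for \<open>\<mu>\<close> and \<open>\<nu>\<close> satisfying \<^const>\<open>compact_nonneg_distribution\<close>.
\<close>

definition free_mult_conv :: "real measure \<Rightarrow> real measure \<Rightarrow> real measure" where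
  "free_mult_conv \<mu> \<nu> = (THE \<rho>. compact_nonneg_distribution \<rho> \<and>
     (\<exists>\<tau> :: bool ncpoly \<Rightarrow> complex.
        let X = nc_var False; Y = nc_var True in
        unital_functional \<tau> \<and> free_variables \<tau> \<and>
        (\<forall>n. \<tau> (X ^ n) = complex_of_real (moment \<mu> n)) \<and>
        (\<forall>n. \<tau> (Y ^ n) = complex_of_real (moment \<nu> n)) \<and>
        (\<forall>n. \<tau> ((X * Y) ^ n) = complex_of_real (moment \<rho> n))))"

text \<open>The power \<open>0\<close> is the unit of the convolution, the point mass at \<open>1\<close>.\<close>

primrec free_mult_conv_power :: "real measure \<Rightarrow> nat \<Rightarrow> real measure" where
  "free_mult_conv_power \<mu> 0 = return borel 1"
| "free_mult_conv_power \<mu> (Suc r) = free_mult_conv (free_mult_conv_power \<mu> r) \<mu>"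

section \<open>Measures on the real line\<close>

definition measure_support :: "real measure \<Rightarrow> real set" where
  "measure_support \<mu> = {x. \<forall>U. open U \<longrightarrow> x \<in> U \<longrightarrow> emeasure \<mu> U > 0}"

definition arcsine_distribution :: "real measure" where
  "arcsine_distribution =
     density lborel (\<lambda>x. ennreal (indicator {0<..<1} x * (1 / (pi * sqrt (x * (1 - x))))))"

end

theory Submission
  imports
    Defs
    "HOL-Computational_Algebra.Formal_Power_Series"
    "HOL-Real_Asymp.Real_Asymp"
begin

text \<open>
  Write \<open>M\<^sub>\<mu>\<close> for the moment generating series of \<open>\<mu>\<close>, and call a series \<open>\<chi>\<close> without constant
  term an inverse for \<open>\<mu>\<close> if \<open>M\<^sub>\<mu> \<circ> \<chi> = 1 + t\<close>; then \<open>\<chi> (1 + t) / t\<close> is the S-transform of \<open>\<mu>\<close>.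
  The arcsine distribution has the inverse \<open>t (2 + t) / (1 + t)\<^sup>2\<close>, so by multiplicativity of the
  S-transform its \<open>r\<close>-th power must have the inverse \<open>t (2 + t)\<^sup>r / (1 + t)\<^sup>r\<^sup>+\<^sup>1\<close>. The
  proof constructs the measure with the stated density, shows that it has this inverse, and
  identifies it with the convolution power by induction on \<open>r\<close>, using that a compactly supported
  measure is determined by its moments (\<open>compact_distribution_eqI\<close>).

  Multiplicativity (\<open>free_product_moment_series\<close>) is proved directly from the freeness condition, for
  power series in \<open>t\<close> with noncommutative coefficients. If \<open>\<alpha>\<close>, \<open>\<beta>\<close> are inverses for the free
  variables \<open>X\<close>, \<open>Y\<close> and \<open>A = (1 - \<alpha> X)\<^sup>-\<^sup>1\<close>, \<open>B = (1 - \<beta> Y)\<^sup>-\<^sup>1\<close>, then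
  \<open>A = 1 + t + t a\<close> and \<open>B = 1 + t + t b\<close> with centered \<open>a\<close>, \<open>b\<close>, and for \<open>z = \<alpha> \<beta> (1 + t) / t\<close>
  one has \<open>A (1 - z X Y) B = 1 + t - t a b\<close>. Hence \<open>(1 - z X Y)\<^sup>-\<^sup>1 = B (1 + t - t a b)\<^sup>-\<^sup>1 A\<close>. In
  the expansion of the right-hand side all alternating products of centered elements are killed
  by the functional, and what remains is \<open>1 + t\<close>.

  The definition of the convolution also requires a functional under which the two variables are
  free. It is defined by recursion on the length of words (\<open>free_functional_exists\<close>): the
  alternating products of the elements \<open>X\<^sub>i\<^sup>k - m\<^sub>i\<^sub>k\<close> are unitriangular over the words, so their
  values can be prescribed to be zero.

  For the moments of the density, the substitution \<open>u = t / (2 + t)\<close> turns the inverse into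
  \<open>2\<^sup>r\<^sup>+\<^sup>1 u / (1 + u)\<^sup>r\<^sup>+\<^sup>1\<close> and \<open>1 + t\<close> into \<open>(1 + u) / (1 - u)\<close>. On the curve
  \<open>u(\<phi>) = sin \<phi> / sin (r \<phi>) \<cdot> exp (i (r + 1) \<phi>)\<close> the reciprocal
  \<open>x = (1 + u)\<^sup>r\<^sup>+\<^sup>1 / (2\<^sup>r\<^sup>+\<^sup>1 u)\<close> is real and equal to \<open>x(\<phi>)\<close>, and the density is
  \<open>Im ((1 + u) / (1 - u)) / (\<pi> x)\<close>. So the \<open>n\<close>-th moment is, up to the factor \<open>- 1 / \<pi>\<close>, the
  increment along the curve of the imaginary part of a primitive of
  \<open>x\<^sup>n ((r - 1) / (1 - u) - 1 / u)\<close>. Only the term \<open>1 / u\<close> of its Laurent expansion at \<open>0\<close> contributes, because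
  the curve runs from \<open>1 / r\<close> to \<open>- 1\<close> through the upper half-plane
  (\<open>curve_primitive_moment\<close>, \<open>raney_density_moment\<close>). The resulting coefficients
  are those given by Lagrange inversion (\<open>raney_moment_series\<close>).
\<close>

unbundle no vec_syntax
unbundle fps_syntax

section \<open>Scalars in the algebra of noncommutative polynomials\<close>

lemma ncpoly_sum_single:
  "p = (\<Sum>w\<in>Poly_Mapping.keys p. Poly_Mapping.single w (Poly_Mapping.lookup p w))"
proof (rule poly_mapping_eqI)
  fix w
  show "Poly_Mapping.lookup p w =
    Poly_Mapping.lookup (\<Sum>w\<in>Poly_Mapping.keys p. Poly_Mapping.single w (Poly_Mapping.lookup p w)) w"
    by (auto simp: lookup_sum lookup_single when_def in_keys_iff)
qed

lemma nc_const_0 [simp]: "nc_const 0 = 0"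
  by (simp add: nc_const_def)

lemma nc_const_1 [simp]: "nc_const 1 = 1"
  by (simp add: nc_const_def)

lemma nc_const_add: "nc_const (c + d) = nc_const c + nc_const d"
  by (simp add: nc_const_def single_add)

lemma nc_const_mult: "nc_const (c * d) = nc_const c * nc_const d"
  by (simp add: nc_const_def mult_single)

lemma nc_const_minus: "nc_const (- c) = - nc_const c"
  by (simp add: nc_const_def single_uminus)

lemma nc_const_sum: "nc_const (sum f A) = (\<Sum>a\<in>A. nc_const (f a))"
  by (induction A rule: infinite_finite_induct) (simp_all add: nc_const_add)

lemma nc_const_commute: "p * nc_const c = nc_const c * p"
proof -
  have "(\<Sum>w\<in>Poly_Mapping.keys p. Poly_Mapping.single w (Poly_Mapping.lookup p w)) * nc_const c =
        nc_const c * (\<Sum>w\<in>Poly_Mapping.keys p. Poly_Mapping.single w (Poly_Mapping.lookup p w))"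
    by (simp add: sum_distrib_left sum_distrib_right nc_const_def mult_single mult.commute)
  then show ?thesis using ncpoly_sum_single[of p] by simp
qed

lemma unital_functional_linear:
  assumes "unital_functional \<tau>"
  shows "\<tau> 1 = 1" "\<tau> (a + b) = \<tau> a + \<tau> b" "\<tau> (nc_const c * a) = c * \<tau> a"
    "\<tau> 0 = 0" "\<tau> (- a) = - \<tau> a" "\<tau> (a - b) = \<tau> a - \<tau> b" "\<tau> (nc_const c) = c"
    "\<tau> (sum f A) = (\<Sum>x\<in>A. \<tau> (f x))"
proof -
  have one: "\<tau> 1 = 1" and add: "\<And>a b. \<tau> (a + b) = \<tau> a + \<tau> b"
    and scale: "\<And>c a. \<tau> (nc_const c * a) = c * \<tau> a"
    using assms unfolding unital_functional_def by auto
  have zero: "\<tau> 0 = 0" using add[of 0 0] by simp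
  have neg: "\<tau> (- a) = - \<tau> a" for a
    using add[of a "- a"] zero by (simp add: eq_neg_iff_add_eq_0 add.commute)
  show "\<tau> 1 = 1" "\<tau> (a + b) = \<tau> a + \<tau> b" "\<tau> (nc_const c * a) = c * \<tau> a"
    "\<tau> 0 = 0" "\<tau> (- a) = - \<tau> a"
    by (fact one add scale zero neg)+
  show "\<tau> (a - b) = \<tau> a - \<tau> b" using add[of a "- b"] neg by simp
  show "\<tau> (nc_const c) = c" using scale[of c 1] one by simp
  show "\<tau> (sum f A) = (\<Sum>x\<in>A. \<tau> (f x))"
    by (induction A rule: infinite_finite_induct) (simp_all add: zero add)
qed

lemma nc_eval_ge_degree:
  assumes "degree p \<le> n"
  shows "nc_eval p a = (\<Sum>k\<le>n. nc_const (coeff p k) * a ^ k)"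
  unfolding nc_eval_def
  by (rule sum.mono_neutral_left) (use assms in \<open>auto simp: coeff_eq_0\<close>)

lemma nc_eval_coeffs:
  "(\<Sum>k\<le>n. nc_const (c k) * a ^ k) = nc_eval (\<Sum>k\<le>n. monom (c k) k) a"
proof -
  have "degree (\<Sum>k\<le>n. monom (c k) k) \<le> n"
    by (intro degree_sum_le) (auto intro: order_trans[OF degree_monom_le])
  then have "nc_eval (\<Sum>k\<le>n. monom (c k) k) a =
      (\<Sum>k\<le>n. nc_const (coeff (\<Sum>j\<le>n. monom (c j) j) k) * a ^ k)"
    by (rule nc_eval_ge_degree)
  also have "\<dots> = (\<Sum>k\<le>n. nc_const (c k) * a ^ k)"
    by (intro sum.cong refl) (simp add: coeff_sum)
  finally show ?thesis by simp
qed

lemma nc_eval_add_const: "nc_eval (p + [:c:]) a = nc_eval p a + nc_const c"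
proof -
  let ?n = "degree p"
  have d: "degree (p + [:c:]) \<le> ?n"
    by (simp add: degree_add_le)
  have "nc_eval (p + [:c:]) a = (\<Sum>k\<le>?n. nc_const (coeff p k) * a ^ k)
      + (\<Sum>k\<le>?n. nc_const (coeff [:c:] k) * a ^ k)"
    unfolding nc_eval_ge_degree[OF d] by (simp add: nc_const_add distrib_right sum.distrib)
  also have "(\<Sum>k\<le>?n. nc_const (coeff [:c:] k) * a ^ k) = (\<Sum>k\<in>{0}. nc_const (coeff [:c:] k) * a ^ k)"
    by (rule sum.mono_neutral_right) (auto simp: coeff_pCons split: nat.splits)
  finally show ?thesis by (simp add: nc_eval_def)
qed

section \<open>Products of centered elements of free subalgebras\<close>

text \<open>The elements of the algebra generated by \<open>X\<^sub>i\<close> that are annihilated by \<open>\<tau>\<close>.\<close>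

definition centered :: "('i ncpoly \<Rightarrow> complex) \<Rightarrow> 'i \<Rightarrow> 'i ncpoly \<Rightarrow> bool" where
  "centered \<tau> i a \<longleftrightarrow> (\<exists>p. a = nc_eval p (nc_var i)) \<and> \<tau> a = 0"

text \<open>
  Factors of an alternating product of centered elements, each listed with the index of its
  algebra; neighbouring indices differ.
\<close>

definition alternating :: "('i ncpoly \<Rightarrow> complex) \<Rightarrow> ('i \<times> 'i ncpoly) list \<Rightarrow> bool" where
  "alternating \<tau> L \<longleftrightarrow> distinct_adj (map fst L) \<and> (\<forall>(i, a) \<in> set L. centered \<tau> i a)"

text \<open>
  The freeness condition, stated for the elements themselves rather than for the polynomials that
  represent them.
\<close>

lemma free_alternating:
  fixes \<tau> :: "'i ncpoly \<Rightarrow> complex"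
  assumes free: "free_variables \<tau>" and alt: "alternating \<tau> L" and ne: "L \<noteq> []"
  shows "\<tau> (prod_list (map snd L)) = 0"
proof -
  define P :: "'i \<times> 'i ncpoly \<Rightarrow> complex poly"
    where "P = (\<lambda>(i, a). SOME p. a = nc_eval p (nc_var i))"
  have P: "a = nc_eval (P (i, a)) (nc_var i)" if "(i, a) \<in> set L" for i a
  proof -
    from alt that have "\<exists>p. a = nc_eval p (nc_var i)"
      by (auto simp: alternating_def centered_def)
    then show ?thesis unfolding P_def split by (rule someI_ex)
  qed
  define ps where "ps = map (\<lambda>x. (fst x, P x)) L"
  have "map fst ps = map fst L" by (simp add: ps_def)
  moreover have "\<forall>(i, p) \<in> set ps. \<tau> (nc_eval p (nc_var i)) = 0"
  proof (safe)
    fix i p assume "(i, p) \<in> set ps"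
    then obtain a where a: "(i, a) \<in> set L" "p = P (i, a)"
      by (auto simp: ps_def)
    with P[OF a(1)] alt show "\<tau> (nc_eval p (nc_var i)) = 0"
      by (auto simp: alternating_def centered_def)
  qed
  moreover have "ps \<noteq> []" using ne by (simp add: ps_def)
  ultimately have "\<tau> (prod_list (map (\<lambda>(i, p). nc_eval p (nc_var i)) ps)) = 0"
    using free alt unfolding free_variables_def alternating_def by metis
  also have "map (\<lambda>(i, p). nc_eval p (nc_var i)) ps = map snd L"
    using P by (auto simp: ps_def)
  finally show ?thesis .
qed

text \<open>
  The elements that behave like a sum of alternating products of centered elements whose first
  factor lies in the algebra of \<open>X\<^sub>i\<close> and whose last factor lies in the algebra of \<open>X\<^sub>j\<close>: every
  extension to a longer alternating product, and the element itself, is annihilated by \<open>\<tau>\<close>.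
\<close>

definition alternating_span :: "('i ncpoly \<Rightarrow> complex) \<Rightarrow> 'i \<Rightarrow> 'i \<Rightarrow> 'i ncpoly set" where
  "alternating_span \<tau> i j = {p. \<forall>K L. alternating \<tau> K \<longrightarrow> alternating \<tau> L \<longrightarrow>
     (K \<noteq> [] \<longrightarrow> fst (last K) \<noteq> i) \<longrightarrow> (L \<noteq> [] \<longrightarrow> fst (hd L) \<noteq> j) \<longrightarrow>
     \<tau> (prod_list (map snd K) * p * prod_list (map snd L)) = 0}"

lemma alternating_Nil [simp]: "alternating \<tau> []"
  by (simp add: alternating_def)

lemma alternating_single: "alternating \<tau> [(i, a)] \<longleftrightarrow> centered \<tau> i a"
  by (simp add: alternating_def)

lemma alternating_append:
  "alternating \<tau> (K @ L) \<longleftrightarrow> alternating \<tau> K \<and> alternating \<tau> L \<and>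
     (K \<noteq> [] \<longrightarrow> L \<noteq> [] \<longrightarrow> fst (last K) \<noteq> fst (hd L))"
  unfolding alternating_def
  by (auto simp: distinct_adj_append_iff last_map hd_map)

lemma alternating_span_product:
  assumes "free_variables \<tau>" "i \<noteq> j" "centered \<tau> i a" "centered \<tau> j b"
  shows "a * b \<in> alternating_span \<tau> i j"
  unfolding alternating_span_def
proof (intro CollectI allI impI)
  fix K L
  assume *: "alternating \<tau> K" "alternating \<tau> L" "K \<noteq> [] \<longrightarrow> fst (last K) \<noteq> i"
    "L \<noteq> [] \<longrightarrow> fst (hd L) \<noteq> j"
  have "alternating \<tau> [(i, a), (j, b)]"
    using assms by (simp add: alternating_def)
  with * have "alternating \<tau> (K @ [(i, a), (j, b)] @ L)"
    by (auto simp: alternating_append simp del: append_Cons)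
  from free_alternating[OF assms(1) this]
  show "\<tau> (prod_list (map snd K) * (a * b) * prod_list (map snd L)) = 0"
    by (simp add: mult.assoc)
qed

lemma alternating_span_product_mult:
  assumes "i \<noteq> j" "centered \<tau> i a" "centered \<tau> j b" "p \<in> alternating_span \<tau> i j"
  shows "a * b * p \<in> alternating_span \<tau> i j"
  unfolding alternating_span_def
proof (intro CollectI allI impI)
  fix K L
  assume *: "alternating \<tau> K" "alternating \<tau> L" "K \<noteq> [] \<longrightarrow> fst (last K) \<noteq> i"
    "L \<noteq> [] \<longrightarrow> fst (hd L) \<noteq> j"
  have "alternating \<tau> [(i, a), (j, b)]"
    using assms by (simp add: alternating_def)
  with * have K: "alternating \<tau> (K @ [(i, a), (j, b)])"
    by (auto simp: alternating_append simp del: append_Cons)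
  have "\<tau> (prod_list (map snd (K @ [(i, a), (j, b)])) * p * prod_list (map snd L)) = 0"
    using assms(4) K * \<open>i \<noteq> j\<close> unfolding alternating_span_def by fastforce
  then show "\<tau> (prod_list (map snd K) * (a * b * p) * prod_list (map snd L)) = 0"
    by (simp add: mult.assoc)
qed

lemma alternating_span_subspace:
  assumes "unital_functional \<tau>"
  shows "0 \<in> alternating_span \<tau> i j"
    "p \<in> alternating_span \<tau> i j \<Longrightarrow> q \<in> alternating_span \<tau> i j \<Longrightarrow> p + q \<in> alternating_span \<tau> i j"
    "p \<in> alternating_span \<tau> i j \<Longrightarrow> nc_const c * p \<in> alternating_span \<tau> i j"
proof -
  note lin = unital_functional_linear[OF assms]
  show "0 \<in> alternating_span \<tau> i j" by (simp add: alternating_span_def lin)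
  show "p + q \<in> alternating_span \<tau> i j"
    if "p \<in> alternating_span \<tau> i j" "q \<in> alternating_span \<tau> i j"
    using that by (simp add: alternating_span_def lin distrib_left distrib_right)
  have "u * (nc_const c * p) * v = nc_const c * (u * p * v)" for u v
    by (metis mult.assoc nc_const_commute)
  then show "nc_const c * p \<in> alternating_span \<tau> i j" if "p \<in> alternating_span \<tau> i j"
    using that by (simp add: alternating_span_def lin)
qed

lemma alternating_span_sum:
  assumes "unital_functional \<tau>" "\<And>k. k \<in> A \<Longrightarrow> f k \<in> alternating_span \<tau> i j"
  shows "sum f A \<in> alternating_span \<tau> i j"
  using assms(2)
  by (induction A rule: infinite_finite_induct)
     (simp_all add: alternating_span_subspace[OF assms(1)])

lemma alternating_span_eq_0:
  assumes "p \<in> alternating_span \<tau> i j" "i \<noteq> j" "unital_functional \<tau>"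
  shows "\<tau> p = 0"
    and "centered \<tau> j b \<Longrightarrow> \<tau> (b * p) = 0"
    and "centered \<tau> i a \<Longrightarrow> \<tau> (p * a) = 0"
    and "centered \<tau> j b \<Longrightarrow> centered \<tau> i a \<Longrightarrow> \<tau> (b * p * a) = 0"
proof -
  have *: "\<tau> (prod_list (map snd K) * p * prod_list (map snd L)) = 0"
    if "alternating \<tau> K" "alternating \<tau> L" "K \<noteq> [] \<longrightarrow> fst (last K) \<noteq> i"
      "L \<noteq> [] \<longrightarrow> fst (hd L) \<noteq> j" for K L
    using assms(1) that unfolding alternating_span_def by blast
  show "\<tau> p = 0" using *[of "[]" "[]"] by simp
  show "\<tau> (b * p) = 0" if "centered \<tau> j b"
    using *[of "[(j, b)]" "[]"] that assms(2) by (simp add: alternating_single)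
  show "\<tau> (p * a) = 0" if "centered \<tau> i a"
    using *[of "[]" "[(i, a)]"] that assms(2) by (simp add: alternating_single)
  show "\<tau> (b * p * a) = 0" if "centered \<tau> j b" "centered \<tau> i a"
    using *[of "[(j, b)]" "[(i, a)]"] that assms(2) by (simp add: alternating_single)
qed

section \<open>Power series with noncommutative coefficients\<close>

text \<open>
  The geometric series \<open>1 + f + f\<^sup>2 + \<dots>\<close> of a power series without constant term over a ring that
  need not be commutative. The powers beyond \<open>f\<^sup>k\<close> do not contribute to the coefficient of \<open>t\<^sup>k\<close>.
\<close>

definition fps_geometric :: "'a :: ring_1 fps \<Rightarrow> 'a fps" where
  "fps_geometric f = Abs_fps (\<lambda>k. (\<Sum>n\<le>k. f ^ n) $ k)"

lemma sum_powers_mult: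
  fixes f :: "'a :: ring_1"
  shows "(\<Sum>n\<le>N. f ^ n) * (1 - f) = 1 - f ^ Suc N" "(1 - f) * (\<Sum>n\<le>N. f ^ n) = 1 - f ^ Suc N"
proof (induction N)
  case (Suc N)
  {
    case 1
    show ?case by (simp only: sum.atMost_Suc distrib_right Suc.IH(1))
      (simp add: right_diff_distrib power_commutes mult.assoc)
  next
    case 2
    show ?case by (simp only: sum.atMost_Suc distrib_left Suc.IH(2))
      (simp add: left_diff_distrib power_commutes mult.assoc)
  }
qed simp_all

lemma fps_geometric_nth:
  assumes "f $ 0 = 0" "k \<le> N"
  shows "fps_geometric f $ k = (\<Sum>n\<le>N. f ^ n) $ k"
proof -
  have "(\<Sum>n\<le>N. f ^ n $ k) = (\<Sum>n\<le>k. f ^ n $ k)"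
    using assms startsby_zero_power_prefix[OF assms(1)]
    by (intro sum.mono_neutral_right) auto
  then show ?thesis by (simp add: fps_geometric_def fps_sum_nth)
qed

lemma fps_geometric_inverse:
  fixes f :: "'a :: ring_1 fps"
  assumes "f $ 0 = 0"
  shows "fps_geometric f * (1 - f) = 1" "(1 - f) * fps_geometric f = 1"
proof -
  have z: "(f ^ Suc k) $ k = 0" for k
    using startsby_zero_power_prefix[OF assms, of "Suc k"] by blast
  show "fps_geometric f * (1 - f) = 1"
  proof (rule fps_ext)
    fix k
    have "(fps_geometric f * (1 - f)) $ k = ((\<Sum>n\<le>k. f ^ n) * (1 - f)) $ k"
      unfolding fps_mult_nth by (intro sum.cong refl) (simp add: fps_geometric_nth[OF assms, of _ k])
    also have "\<dots> = (1 - f ^ Suc k) $ k"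
      by (simp only: sum_powers_mult)
    also have "\<dots> = 1 $ k" using z[of k] by (simp only: fps_sub_nth diff_zero)
    finally show "(fps_geometric f * (1 - f)) $ k = 1 $ k" .
  qed
  show "(1 - f) * fps_geometric f = 1"
  proof (rule fps_ext)
    fix k
    have "((1 - f) * fps_geometric f) $ k = ((1 - f) * (\<Sum>n\<le>k. f ^ n)) $ k"
      unfolding fps_mult_nth by (intro sum.cong refl) (simp add: fps_geometric_nth[OF assms, of _ k])
    also have "\<dots> = (1 - f ^ Suc k) $ k"
      by (simp only: sum_powers_mult)
    also have "\<dots> = 1 $ k" using z[of k] by (simp only: fps_sub_nth diff_zero)
    finally show "((1 - f) * fps_geometric f) $ k = 1 $ k" .
  qed
qed

text \<open>Scalar power series inside the power series with coefficients in \<open>'i ncpoly\<close>.\<close>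

definition nc_fps :: "complex fps \<Rightarrow> 'i ncpoly fps" where
  "nc_fps f = Abs_fps (\<lambda>n. nc_const (f $ n))"

lemma nc_fps_nth [simp]: "nc_fps f $ n = nc_const (f $ n)"
  by (simp add: nc_fps_def)

lemma nc_fps_add: "nc_fps (f + g) = nc_fps f + nc_fps g"
  by (rule fps_ext) (simp add: nc_const_add)

lemma nc_fps_mult: "nc_fps (f * g) = nc_fps f * nc_fps g"
  by (rule fps_ext) (simp add: fps_mult_nth nc_const_sum nc_const_mult)

lemma nc_fps_1 [simp]: "nc_fps 1 = 1"
  by (rule fps_ext) simp

lemma nc_fps_X [simp]: "nc_fps fps_X = fps_X"
  by (rule fps_ext) (simp add: fps_X_def)

lemma nc_fps_commute: "f * nc_fps g = nc_fps g * f"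
proof (rule fps_ext)
  fix n
  have "(f * nc_fps g) $ n = (\<Sum>i=0..n. nc_const (g $ (n - i)) * f $ i)"
    by (simp add: fps_mult_nth nc_const_commute)
  also have "\<dots> = (\<Sum>i=0..n. nc_const (g $ i) * f $ (n - i))"
    by (rule sum.reindex_bij_witness[of _ "\<lambda>i. n - i" "\<lambda>i. n - i"]) auto
  finally show "(f * nc_fps g) $ n = (nc_fps g * f) $ n" by (simp add: fps_mult_nth)
qed

lemma nc_fps_left_commute: "f * (nc_fps g * h) = nc_fps g * (f * h)"
  by (metis mult.assoc nc_fps_commute)

lemma nc_fps_times_const_power: "(nc_fps f * fps_const a) ^ n = nc_fps (f ^ n) * fps_const (a ^ n)"
proof (induction n)
  case (Suc n)
  have "(nc_fps f * fps_const a) ^ Suc n = nc_fps f * fps_const a * (nc_fps (f ^ n) * fps_const (a ^ n))"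
    using Suc by simp
  also have "\<dots> = (nc_fps f * nc_fps (f ^ n)) * (fps_const a * fps_const (a ^ n))"
    by (simp only: mult.assoc nc_fps_left_commute[of "fps_const a"])
  finally show ?case by (simp add: nc_fps_mult fps_const_mult)
qed simp

lemma fps_geometric_scaled_nth:
  "fps_geometric (nc_fps f * fps_const a) $ k = (\<Sum>n\<le>k. nc_const ((f ^ n) $ k) * a ^ n)"
  by (simp add: fps_geometric_def fps_sum_nth nc_fps_times_const_power)

text \<open>Coefficientwise application of a functional.\<close>

definition fps_functional :: "('i ncpoly \<Rightarrow> complex) \<Rightarrow> 'i ncpoly fps \<Rightarrow> complex fps" where
  "fps_functional \<tau> f = Abs_fps (\<lambda>n. \<tau> (f $ n))"

lemma fps_functional_linear:
  assumes "unital_functional \<tau>"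
  shows "fps_functional \<tau> (f + g) = fps_functional \<tau> f + fps_functional \<tau> g"
    "fps_functional \<tau> (f - g) = fps_functional \<tau> f - fps_functional \<tau> g"
    "fps_functional \<tau> (nc_fps h * f) = h * fps_functional \<tau> f"
    "fps_functional \<tau> (nc_fps h) = h"
  by (rule fps_ext; simp add: fps_functional_def fps_mult_nth unital_functional_linear[OF assms])+

text \<open>The resolvent \<open>(1 - f a)\<^sup>-\<^sup>1\<close> is mapped to the moment series of \<open>a\<close>, evaluated at \<open>f\<close>.\<close>

lemma fps_functional_geometric:
  assumes "unital_functional \<tau>"
  shows "fps_functional \<tau> (fps_geometric (nc_fps f * fps_const a)) = Abs_fps (\<lambda>n. \<tau> (a ^ n)) oo f"
  by (rule fps_ext)
     (simp add: fps_functional_def fps_geometric_scaled_nth fps_compose_nth atLeast0AtMost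
        unital_functional_linear[OF assms] mult.commute)

section \<open>Multiplicativity of the S-transform\<close>

text \<open>
  If \<open>a\<close> and \<open>b\<close> have centered coefficients, then the inverse \<open>F\<close> of \<open>1 + t - t a b\<close> has scalar
  part \<open>(1 + t)\<^sup>-\<^sup>1\<close>, and the coefficients of the rest behave like alternating products that begin in
  the algebra of \<open>X\<^sub>i\<close> and end in that of \<open>X\<^sub>j\<close>.
\<close>

lemma fps_inverse_alternating:
  fixes a b F :: "'i ncpoly fps"
  assumes \<tau>: "unital_functional \<tau>" "free_variables \<tau>" and ij: "i \<noteq> j"
    and a: "\<And>n. centered \<tau> i (a $ n)" and b: "\<And>n. centered \<tau> j (b $ n)"
    and EF: "(1 + fps_X - fps_X * (a * b)) * F = 1"
  shows "F $ n - nc_const (inverse (1 + fps_X) $ n) \<in> alternating_span \<tau> i j"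
proof (induction n rule: less_induct)
  case (less n)
  note sub = alternating_span_subspace[OF \<tau>(1)]
  define c where "c = inverse (1 + fps_X :: complex fps)"
  have c: "(1 + fps_X) * c = 1"
    unfolding c_def using inverse_mult_eq_1[of "1 + fps_X :: complex fps"] by (simp add: mult.commute)
  \<comment> \<open>The equations for \<open>F\<close> and \<open>c\<close> are recursions for their coefficients.\<close>
  have F: "F = 1 - fps_X * F + fps_X * (a * b * F)"
    using EF by (simp add: algebra_simps mult.assoc)
  have c': "c = 1 - fps_X * c" using c by (simp add: algebra_simps)
  show ?case
  proof (cases n)
    case 0
    have "F $ 0 = 1" by (subst F) simp
    moreover have "c $ 0 = 1" by (subst c') simp
    ultimately show ?thesis using sub(1) 0 by (simp add: c_def[symmetric])
  next
    case (Suc m)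
    define \<omega> where "\<omega> k = F $ k - nc_const (c $ k)" for k
    have \<omega>: "\<omega> k \<in> alternating_span \<tau> i j" if "k \<le> m" for k
      using less.IH[of k] that Suc by (simp add: \<omega>_def c_def)
    have "F $ Suc m = - F $ m + (a * b * F) $ m"
      by (subst F) simp
    moreover have "c $ Suc m = - c $ m" by (subst c') simp
    ultimately have *: "F $ n - nc_const (c $ n) = nc_const (- 1) * \<omega> m + (a * b * F) $ m"
      using Suc by (simp add: \<omega>_def nc_const_minus)
    have "a $ k * b $ l * F $ q \<in> alternating_span \<tau> i j" if "q \<le> m" for k l q
    proof -
      have "a $ k * b $ l * F $ q = nc_const (c $ q) * (a $ k * b $ l) + a $ k * b $ l * \<omega> q"
        by (simp add: \<omega>_def algebra_simps nc_const_commute)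
      then show ?thesis
        using alternating_span_product[OF \<tau>(2) ij a b]
          alternating_span_product_mult[OF ij a b \<omega>[OF that]] sub by metis
    qed
    then have "(a * b * F) $ m \<in> alternating_span \<tau> i j"
      unfolding fps_mult_nth[of "a * b"] fps_mult_nth[of a] sum_distrib_right
      by (intro alternating_span_sum[OF \<tau>(1)]) simp
    then show ?thesis
      unfolding c_def[symmetric] * using \<omega>[of m] sub by simp
  qed
qed

lemma fps_X_mult_cancel:
  fixes f g :: "'a :: semiring_1 fps"
  assumes "fps_X * f = fps_X * g"
  shows "f = g"
proof (rule fps_ext)
  fix n
  have "(fps_X * f) $ Suc n = (fps_X * g) $ Suc n" using assms by simp
  then show "f $ n = g $ n" by simp
qed

text \<open>
  The resolvent of a variable, evaluated at the inverse \<open>\<alpha>\<close> of its moment series, is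
  \<open>1 + t\<close> plus \<open>t\<close> times a series with centered coefficients.
\<close>

lemma resolvent_centered:
  fixes \<tau> :: "'i ncpoly \<Rightarrow> complex"
  assumes \<tau>: "unital_functional \<tau>" and \<alpha>0: "\<alpha> $ 0 = 0"
    and \<alpha>: "Abs_fps (\<lambda>n. \<tau> (nc_var i ^ n)) oo \<alpha> = 1 + fps_X"
  obtains a where "\<And>n. centered \<tau> i (a $ n)"
    and "fps_geometric (nc_fps \<alpha> * fps_const (nc_var i)) = 1 + fps_X + fps_X * a"
proof
  define A where "A = fps_geometric (nc_fps \<alpha> * fps_const (nc_var i))"
  define a where "a = Abs_fps (\<lambda>n. (A - nc_fps (1 + fps_X)) $ Suc n)"
  have "(A - nc_fps (1 + fps_X)) $ 0 = 0"
    by (simp add: A_def fps_geometric_scaled_nth)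
  then have "(A - nc_fps (1 + fps_X)) = fps_X * a"
    by (intro fps_ext) (simp add: a_def fps_X_mult_nth del: fps_sub_nth)
  then show "fps_geometric (nc_fps \<alpha> * fps_const (nc_var i)) = 1 + fps_X + fps_X * a"
    by (simp add: A_def nc_fps_add algebra_simps)
  show "centered \<tau> i (a $ n)" for n
    unfolding centered_def
  proof
    have "a $ n = (\<Sum>k\<le>Suc n. nc_const ((\<alpha> ^ k) $ Suc n) * nc_var i ^ k)
        + nc_const (- ((1 + fps_X) $ Suc n))"
      by (simp only: a_def A_def fps_nth_Abs_fps fps_sub_nth fps_geometric_scaled_nth nc_fps_nth
            nc_const_minus) simp
    then show "\<exists>p. a $ n = nc_eval p (nc_var i)"
      by (metis nc_eval_coeffs nc_eval_add_const)
    have "fps_functional \<tau> (A - nc_fps (1 + fps_X)) = 0"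
      unfolding fps_functional_linear[OF \<tau>] A_def fps_functional_geometric[OF \<tau>] \<alpha> by simp
    then have "fps_functional \<tau> (A - nc_fps (1 + fps_X)) $ Suc n = 0" by simp
    then show "\<tau> (a $ n) = 0" by (simp add: fps_functional_def a_def)
  qed
qed

text \<open>
  If \<open>\<alpha>\<close> and \<open>\<beta>\<close> are the inverses of the moment series (without constant term) of two free
  variables \<open>X\<close>, \<open>Y\<close>, then \<open>\<alpha> \<beta> (1 + t) / t\<close> is the inverse for \<open>X Y\<close>.
\<close>

theorem free_product_moment_series:
  fixes \<tau> :: "'i ncpoly \<Rightarrow> complex" and \<alpha> \<beta> z :: "complex fps"
  assumes \<tau>: "unital_functional \<tau>" "free_variables \<tau>" and ij: "i \<noteq> j"
    and \<alpha>0: "\<alpha> $ 0 = 0" and \<beta>0: "\<beta> $ 0 = 0"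
    and \<alpha>: "Abs_fps (\<lambda>n. \<tau> (nc_var i ^ n)) oo \<alpha> = 1 + fps_X"
    and \<beta>: "Abs_fps (\<lambda>n. \<tau> (nc_var j ^ n)) oo \<beta> = 1 + fps_X"
    and z: "fps_X * z = \<alpha> * \<beta> * (1 + fps_X)"
  shows "Abs_fps (\<lambda>n. \<tau> ((nc_var i * nc_var j) ^ n)) oo z = 1 + fps_X"
proof -
  define X Y where "X = fps_const (nc_var i :: 'i ncpoly)" and "Y = fps_const (nc_var j :: 'i ncpoly)"
  define A B where "A = fps_geometric (nc_fps \<alpha> * X)" and "B = fps_geometric (nc_fps \<beta> * Y)"
  define s where "s = (1 + fps_X :: complex fps)"
  have [simp]: "nc_fps s = (1 + fps_X :: 'i ncpoly fps)" by (simp add: s_def nc_fps_add)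
  obtain a where a: "\<And>n. centered \<tau> i (a $ n)" and A: "A = 1 + fps_X + fps_X * a"
    using resolvent_centered[OF \<tau>(1) \<alpha>0 \<alpha>] unfolding A_def X_def by blast
  obtain b where b: "\<And>n. centered \<tau> j (b $ n)" and B: "B = 1 + fps_X + fps_X * b"
    using resolvent_centered[OF \<tau>(1) \<beta>0 \<beta>] unfolding B_def Y_def by blast
  have Xc: "f * fps_X = fps_X * f" for f :: "'i ncpoly fps"
    using nc_fps_commute[of f fps_X] by simp
  have Xlc: "f * (fps_X * g) = fps_X * (f * g)" for f g :: "'i ncpoly fps"
    using nc_fps_left_commute[of f fps_X g] by simp
  have A_inv: "A * (1 - nc_fps \<alpha> * X) = 1" "(1 - nc_fps \<alpha> * X) * A = 1"
    unfolding A_def by (rule fps_geometric_inverse; simp add: \<alpha>0)+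
  have B_inv: "B * (1 - nc_fps \<beta> * Y) = 1" "(1 - nc_fps \<beta> * Y) * B = 1"
    unfolding B_def by (rule fps_geometric_inverse; simp add: \<beta>0)+
  have AX: "A * (nc_fps \<alpha> * X) = A - 1" using A_inv(1) by (simp add: algebra_simps)
  have YB: "nc_fps \<beta> * Y * B = B - 1" using B_inv(2) by (simp add: algebra_simps)
  have z0: "z $ 0 = 0"
  proof -
    have "(fps_X * z) $ 1 = 0" unfolding z by (simp add: \<alpha>0 \<beta>0 fps_mult_nth)
    then show ?thesis by simp
  qed
  define D where "D = 1 - nc_fps z * (X * Y)"
  define E where "E = 1 + fps_X - fps_X * (a * b)"
  define F where "F = fps_geometric (fps_X * (a * b) - fps_X)"
  have EF: "E * F = 1"
    using fps_geometric_inverse(2)[of "fps_X * (a * b) - fps_X"]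
    by (simp add: E_def F_def algebra_simps)
  \<comment> \<open>Multiplied by \<open>t\<close>, the identity involves only \<open>t z = \<alpha> \<beta> (1 + t)\<close>, and no division by \<open>t\<close>.\<close>
  have ADB: "A * D * B = E"
  proof (rule fps_X_mult_cancel)
    have "fps_X * (A * (nc_fps z * (X * Y)) * B) = nc_fps (fps_X * z) * (A * (X * Y) * B)"
      by (simp add: nc_fps_mult mult.assoc nc_fps_left_commute)
    also have "\<dots> = nc_fps s * (nc_fps \<alpha> * (nc_fps \<beta> * (A * (X * (Y * B)))))"
      unfolding z s_def[symmetric] nc_fps_mult
      by (simp only: mult.assoc nc_fps_left_commute[of "nc_fps \<alpha>" s] nc_fps_left_commute[of "nc_fps \<beta>" s])
    also have "\<dots> = nc_fps s * ((A * (nc_fps \<alpha> * X)) * (nc_fps \<beta> * Y * B))"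
      by (simp only: mult.assoc nc_fps_left_commute[of A] nc_fps_left_commute[of X])
    also have "\<dots> = (1 + fps_X) * ((A - 1) * (B - 1))"
      by (simp only: AX YB) simp
    finally have "fps_X * (A * D * B) = fps_X * (A * B) - (1 + fps_X) * ((A - 1) * (B - 1))"
      by (simp add: D_def algebra_simps)
    also have "\<dots> = fps_X * E"
      unfolding A B E_def by (simp add: algebra_simps Xc[of a] Xc[of b] Xlc[of a] Xlc[of b])
    finally show "fps_X * (A * D * B) = fps_X * E" .
  qed
  have "D * (B * F * A) = ((1 - nc_fps \<alpha> * X) * A) * D * B * F * A"
    using A_inv(2) by (simp add: mult.assoc)
  also have "\<dots> = (1 - nc_fps \<alpha> * X) * (A * D * B * F) * A"
    by (simp only: mult.assoc)
  also have "\<dots> = 1" using ADB EF A_inv(2) by simp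
  finally have "D * (B * F * A) = 1" .
  then have "fps_geometric (nc_fps z * (X * Y)) = fps_geometric (nc_fps z * (X * Y)) * D * (B * F * A)"
    by (simp add: mult.assoc)
  also have "\<dots> = B * F * A"
    unfolding D_def by (subst fps_geometric_inverse) (simp_all add: z0)
  finally have R: "fps_geometric (nc_fps z * (X * Y)) = B * F * A" .
  \<comment> \<open>Split \<open>B F A\<close> into scalar and centered parts; only the product of the three scalar parts
    survives.\<close>
  define \<omega> where "\<omega> = F - nc_fps (inverse s)"
  have \<omega>: "\<omega> $ n \<in> alternating_span \<tau> i j" for n
    using fps_inverse_alternating[OF \<tau> ij a b EF[unfolded E_def]] by (simp add: \<omega>_def s_def)
  note vanish = alternating_span_eq_0[OF _ ij \<tau>(1)]
  note lin = unital_functional_linear[OF \<tau>(1)]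
  have c: "\<tau> (a $ n) = 0" "\<tau> (b $ n) = 0" for n
    using a b by (auto simp: centered_def)
  have ba: "\<tau> (b $ n * a $ m) = 0" for n m
    using free_alternating[OF \<tau>(2), of "[(j, b $ n), (i, a $ m)]"] a b ij
    by (simp add: alternating_def)
  have T0: "fps_functional \<tau> \<omega> = 0" "fps_functional \<tau> a = 0" "fps_functional \<tau> b = 0"
    "fps_functional \<tau> (b * a) = 0" "fps_functional \<tau> (b * \<omega>) = 0"
    "fps_functional \<tau> (\<omega> * a) = 0" "fps_functional \<tau> (b * \<omega> * a) = 0"
    by (rule fps_ext; simp add: fps_functional_def fps_mult_nth lin sum_distrib_right
        vanish(1)[OF \<omega>] vanish(2)[OF \<omega> b] vanish(3)[OF \<omega> a] vanish(4)[OF \<omega> b a] c ba)+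
  have F: "F = nc_fps (inverse s) + \<omega>" by (simp add: \<omega>_def)
  have AB': "A = nc_fps s + nc_fps fps_X * a" "B = nc_fps s + nc_fps fps_X * b"
    by (simp_all add: A B)
  note comm = nc_fps_commute[of a] nc_fps_commute[of b] nc_fps_commute[of \<omega>]
    nc_fps_left_commute[of a] nc_fps_left_commute[of b] nc_fps_left_commute[of \<omega>]
  have "B * F * A =
      nc_fps (s * inverse s * s) + nc_fps (s * inverse s * fps_X) * a
      + nc_fps (s * s) * \<omega> + nc_fps (s * fps_X) * (\<omega> * a)
      + nc_fps (fps_X * inverse s * s) * b + nc_fps (fps_X * inverse s * fps_X) * (b * a)
      + nc_fps (fps_X * s) * (b * \<omega>) + nc_fps (fps_X * fps_X) * (b * \<omega> * a)"
    unfolding F AB' nc_fps_mult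
    by (simp only: distrib_left distrib_right mult.assoc comm add_ac)
  then have "fps_functional \<tau> (B * F * A) = s * inverse s * s"
    by (simp only: fps_functional_linear[OF \<tau>(1)] T0) simp
  also have "s * inverse s = 1"
    using inverse_mult_eq_1[of s] by (simp add: s_def mult.commute)
  finally have "fps_functional \<tau> (fps_geometric (nc_fps z * (X * Y))) = s"
    unfolding R by simp
  moreover have "X * Y = fps_const (nc_var i * nc_var j)"
    by (simp add: X_def Y_def fps_const_mult)
  ultimately show ?thesis
    using fps_functional_geometric[OF \<tau>(1), of z "nc_var i * nc_var j"] by (simp add: s_def)
qed

section \<open>Existence of the free product functional\<close>

text \<open>
  Run-length encoding: each maximal run of a letter \<open>i\<close> in the word becomes one pair \<open>(i, k)\<close>, where
  \<open>k \<ge> 1\<close> is the length of the run.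
\<close>

fun syllables :: "'i list \<Rightarrow> ('i \<times> nat) list" where
  "syllables [] = []"
| "syllables (x # w) = (case syllables w of
      [] \<Rightarrow> [(x, 1)]
    | (y, k) # L \<Rightarrow> if x = y then (y, Suc k) # L else (x, 1) # (y, k) # L)"

definition of_syllables :: "('i \<times> nat) list \<Rightarrow> 'i list" where
  "of_syllables L = concat (map (\<lambda>(i, k). replicate k i) L)"

lemma of_syllables_simps [simp]:
  "of_syllables [] = []" "of_syllables ((i, k) # L) = replicate k i @ of_syllables L"
  by (simp_all add: of_syllables_def)

lemma syllables_replicate_append:
  assumes "syllables w = [] \<or> fst (hd (syllables w)) \<noteq> i"
  shows "syllables (replicate (Suc k) i @ w) = (i, Suc k) # syllables w"
proof (induction k)
  case 0
  show ?case using assms by (auto split: list.splits)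
next
  case (Suc k)
  then show ?case by simp
qed

lemma syllables_of_syllables:
  assumes "distinct_adj (map fst L)" "\<forall>(i, k) \<in> set L. k > 0"
  shows "syllables (of_syllables L) = L"
  using assms
proof (induction L)
  case (Cons x L)
  obtain i k where x: "x = (i, Suc k)"
    using Cons.prems(2) by (cases x) (auto simp: gr0_conv_Suc)
  have IH: "syllables (of_syllables L) = L"
    using Cons by (auto simp: distinct_adj_Cons)
  have "syllables (of_syllables L) = [] \<or> fst (hd (syllables (of_syllables L))) \<noteq> i"
    using Cons.prems(1) x IH by (cases L) auto
  from syllables_replicate_append[OF this, of k] show ?case
    using IH by (simp add: x del: replicate_Suc)
qed simp

primrec word_length :: "'i ncword \<Rightarrow> nat" where
  "word_length (Word w) = length w"

lemma word_length_add [simp]: "word_length (u + v) = word_length u + word_length v"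
  by (cases u; cases v) simp

lemma word_length_0 [simp]: "word_length 0 = 0"
  by (simp add: zero_ncword_def)

lemma nc_var_power: "nc_var i ^ k = Poly_Mapping.single (Word (replicate k i)) 1"
proof (induction k)
  case 0
  then show ?case by (simp flip: zero_ncword_def)
qed (simp add: nc_var_def mult_single)

lemma lookup_nc_const_mult: "Poly_Mapping.lookup (nc_const c * p) w = c * Poly_Mapping.lookup p w"
proof -
  have "nc_const c * p = Poly_Mapping.map ((*) c) p"
    unfolding nc_const_def by (rule mult_map_scale_conv_mult[symmetric])
  then show ?thesis by (simp add: Poly_Mapping.map.rep_eq when_def)
qed

text \<open>The linear functional with the values \<open>T w\<close> on words.\<close>

definition word_functional :: "('i ncword \<Rightarrow> complex) \<Rightarrow> 'i ncpoly \<Rightarrow> complex" where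
  "word_functional T p = (\<Sum>w\<in>Poly_Mapping.keys p. Poly_Mapping.lookup p w * T w)"

lemma word_functional_superset:
  assumes "finite S" "Poly_Mapping.keys p \<subseteq> S"
  shows "word_functional T p = (\<Sum>w\<in>S. Poly_Mapping.lookup p w * T w)"
  unfolding word_functional_def
  by (rule sum.mono_neutral_left) (use assms in \<open>auto simp: in_keys_iff\<close>)

lemma word_functional_unital:
  assumes "T 0 = 1"
  shows "unital_functional (word_functional T)"
  unfolding unital_functional_def
proof (intro conjI allI)
  show "word_functional T 1 = 1" by (simp add: word_functional_def assms)
  show "word_functional T (p + q) = word_functional T p + word_functional T q" for p q
    unfolding word_functional_def by (rule setsum_keys_plus_distrib) (simp_all add: distrib_right)
  show "word_functional T (nc_const c * p) = c * word_functional T p" for c p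
  proof -
    have "word_functional T (nc_const c * p) =
        (\<Sum>w\<in>Poly_Mapping.keys p. Poly_Mapping.lookup (nc_const c * p) w * T w)"
      by (rule word_functional_superset) (auto simp: in_keys_iff lookup_nc_const_mult)
    then show ?thesis
      by (simp add: lookup_nc_const_mult word_functional_def sum_distrib_left mult.assoc)
  qed
qed

text \<open>
  The values on words for which the functional vanishes on \<open>w + R w\<close> for every nonempty word \<open>w\<close>,
  where \<open>R w\<close> is a combination of words shorter than \<open>w\<close>. Other words in \<open>R w\<close> are ignored, so
  that the recursion terminates for every \<open>R\<close>.
\<close>

function triangular_values :: "('i ncword \<Rightarrow> 'i ncpoly) \<Rightarrow> 'i ncword \<Rightarrow> complex" where
  "triangular_values R w = (if w = 0 then 1 else
     - (\<Sum>v\<in>Poly_Mapping.keys (R w). if word_length v < word_length w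
          then Poly_Mapping.lookup (R w) v * triangular_values R v else 0))"
  by pat_completeness auto
termination by (relation "Wellfounded.measure (\<lambda>(R, w). word_length w)") auto

declare triangular_values.simps [simp del]

lemma triangular_values_0 [simp]: "triangular_values R 0 = 1"
  by (subst triangular_values.simps) simp

lemma triangular_values_functional:
  fixes R :: "'i ncword \<Rightarrow> 'i ncpoly"
  assumes "w \<noteq> 0" and "\<And>v. v \<in> Poly_Mapping.keys (R w) \<Longrightarrow> word_length v < word_length w"
  shows "word_functional (triangular_values R) (Poly_Mapping.single w 1 + R w) = 0"
proof -
  let ?\<tau> = "word_functional (triangular_values R)"
  have "?\<tau> (Poly_Mapping.single w 1 + R w) = ?\<tau> (Poly_Mapping.single w 1) + ?\<tau> (R w)"
    using unital_functional_linear(2)[OF word_functional_unital[of "triangular_values R"]] by simp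
  also have "?\<tau> (Poly_Mapping.single w 1) = triangular_values R w"
    by (simp add: word_functional_def)
  also have "\<dots> = - ?\<tau> (R w)"
    using assms by (subst triangular_values.simps) (simp add: word_functional_def cong: sum.cong)
  finally show ?thesis by simp
qed

context
  fixes m :: "'i \<Rightarrow> nat \<Rightarrow> complex"
  assumes m0: "\<And>i. m i 0 = 1"
begin

text \<open>
  The centered powers \<open>X\<^sub>i\<^sup>k - m\<^sub>i\<^sub>k\<close> for the prescribed moments \<open>m\<^sub>i\<^sub>k\<close> of \<open>X\<^sub>i\<close>, and their products.
\<close>

definition centered_power :: "'i \<Rightarrow> nat \<Rightarrow> 'i ncpoly" where
  "centered_power i k = nc_var i ^ k - nc_const (m i k)"

definition centered_product :: "('i \<times> nat) list \<Rightarrow> 'i ncpoly" where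
  "centered_product L = prod_list (map (\<lambda>(i, k). centered_power i k) L)"

text \<open>A product of centered powers is a word plus a combination of shorter words.\<close>

lemma centered_product_leading:
  assumes "\<forall>(i, k) \<in> set L. k > 0"
    and "v \<in> Poly_Mapping.keys (centered_product L - Poly_Mapping.single (Word (of_syllables L)) 1)"
  shows "word_length v < length (of_syllables L)"
  using assms
proof (induction L arbitrary: v)
  case Nil
  then show ?case by (simp add: centered_product_def flip: zero_ncword_def)
next
  case (Cons x L)
  obtain i k where x: "x = (i, k)" by (cases x)
  have k: "k > 0" using Cons.prems(1) x by auto
  let ?W = "Poly_Mapping.single (Word (of_syllables L)) (1 :: complex)"
  let ?X = "Poly_Mapping.single (Word (replicate k i)) (1 :: complex)"
  define Q where "Q = centered_product L - ?W"
  have Q: "word_length u < length (of_syllables L)" if "u \<in> Poly_Mapping.keys Q" for u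
    using Cons that by (auto simp: Q_def)
  have CL: "word_length u \<le> length (of_syllables L)"
    if "u \<in> Poly_Mapping.keys (centered_product L)" for u
  proof -
    have "centered_product L = ?W + Q" by (simp add: Q_def)
    then have "u \<in> Poly_Mapping.keys ?W \<union> Poly_Mapping.keys Q"
      using that Poly_Mapping.keys_add[of ?W Q] by auto
    then show ?thesis using Q[of u] by auto
  qed
  have "centered_product (x # L) = centered_power i k * centered_product L"
    by (simp add: centered_product_def x)
  also have "\<dots> = ?X * centered_product L - nc_const (m i k) * centered_product L"
    by (simp only: centered_power_def nc_var_power left_diff_distrib)
  also have "?X * centered_product L = ?X * (?W + Q)"
    by (simp add: Q_def)
  also have "?X * (?W + Q) = Poly_Mapping.single (Word (of_syllables (x # L))) 1 + ?X * Q"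
    by (simp add: distrib_left mult_single x)
  finally have *: "centered_product (x # L) - Poly_Mapping.single (Word (of_syllables (x # L))) 1 =
      ?X * Q + nc_const (- m i k) * centered_product L"
    by (simp add: nc_const_minus)
  have "v \<in> Poly_Mapping.keys (?X * Q) \<or> v \<in> Poly_Mapping.keys (nc_const (- m i k) * centered_product L)"
    using Cons.prems(2) subsetD[OF Poly_Mapping.keys_add[of "?X * Q" "nc_const (- m i k) * centered_product L"], of v]
    by (simp only: * Un_iff)
  then show ?case
  proof
    assume "v \<in> Poly_Mapping.keys (?X * Q)"
    then obtain u where "u \<in> Poly_Mapping.keys Q" "v = Word (replicate k i) + u"
      using keys_mult[of ?X Q] by auto
    then show ?thesis using Q[of u] by (simp add: x)
  next
    assume "v \<in> Poly_Mapping.keys (nc_const (- m i k) * centered_product L)"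
    then have "v \<in> Poly_Mapping.keys (centered_product L)"
      by (auto simp: in_keys_iff lookup_nc_const_mult)
    then show ?thesis using CL[of v] k by (simp add: x)
  qed
qed

text \<open>
  The free product functional: it vanishes on the product of centered powers attached to the
  run-length encoding of any nonempty word.
\<close>

definition free_functional :: "'i ncpoly \<Rightarrow> complex" where
  "free_functional = word_functional (triangular_values (\<lambda>w. case w of Word u \<Rightarrow>
     centered_product (syllables u) - Poly_Mapping.single w 1))"

lemma free_functional_unital: "unital_functional free_functional"
  unfolding free_functional_def by (rule word_functional_unital) simp

lemma free_functional_centered_product:
  assumes "distinct_adj (map fst L)" "\<forall>(i, k) \<in> set L. k > 0" "L \<noteq> []"
  shows "free_functional (centered_product L) = 0"
proof -
  let ?R = "\<lambda>w. case w of Word u \<Rightarrow> centered_product (syllables u) - Poly_Mapping.single w 1"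
  define w where "w = Word (of_syllables L)"
  have L: "syllables (of_syllables L) = L" using assms by (intro syllables_of_syllables)
  have "w \<noteq> 0" using assms L by (auto simp: w_def zero_ncword_def)
  moreover have "word_length v < word_length w" if "v \<in> Poly_Mapping.keys (?R w)" for v
    using centered_product_leading[OF assms(2), of v] that by (simp add: w_def L)
  ultimately have "free_functional (Poly_Mapping.single w 1 + ?R w) = 0"
    unfolding free_functional_def by (rule triangular_values_functional)
  then show ?thesis by (simp add: w_def L)
qed

lemma free_functional_power: "free_functional (nc_var i ^ k) = m i k"
proof (cases "k = 0")
  case True
  then show ?thesis
    using unital_functional_linear(1)[OF free_functional_unital] m0 by simp
next
  case False
  then have "free_functional (centered_product [(i, k)]) = 0"
    by (intro free_functional_centered_product) auto
  then show ?thesis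
    by (simp add: centered_product_def centered_power_def
        unital_functional_linear[OF free_functional_unital])
qed

text \<open>A centered polynomial in \<open>X\<^sub>i\<close> is a combination of the centered powers with \<open>k \<ge> 1\<close>.\<close>

lemma nc_eval_centered:
  assumes "free_functional (nc_eval p (nc_var i)) = 0"
  shows "nc_eval p (nc_var i) = (\<Sum>k=1..degree p. nc_const (coeff p k) * centered_power i k)"
proof -
  have 0: "(\<Sum>k\<le>degree p. coeff p k * m i k) = 0"
    using assms unfolding nc_eval_def
    by (simp add: unital_functional_linear[OF free_functional_unital] free_functional_power)
  have "(\<Sum>k\<le>degree p. nc_const (coeff p k) * centered_power i k) =
      nc_eval p (nc_var i) - nc_const (\<Sum>k\<le>degree p. coeff p k * m i k)"
    by (simp add: centered_power_def right_diff_distrib sum_subtractf nc_eval_def nc_const_sum nc_const_mult)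
  then have "nc_eval p (nc_var i) = (\<Sum>k\<le>degree p. nc_const (coeff p k) * centered_power i k)"
    by (simp add: 0)
  also have "\<dots> = (\<Sum>k=1..degree p. nc_const (coeff p k) * centered_power i k)"
    by (rule sum.mono_neutral_right) (auto simp: centered_power_def m0 not_less_eq_eq)
  finally show ?thesis .
qed

lemma free_functional_free: "free_variables free_functional"
proof -
  \<comment> \<open>Replace the polynomial factors one after the other, from the left, by centered powers.\<close>
  have "free_functional (centered_product L * prod_list (map (\<lambda>(i, p). nc_eval p (nc_var i)) ps)) = 0"
    if "distinct_adj (map fst L @ map fst ps)" "\<forall>(i, k) \<in> set L. k > 0" "L \<noteq> [] \<or> ps \<noteq> []"
      "\<forall>(i, p) \<in> set ps. free_functional (nc_eval p (nc_var i)) = 0"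
    for L and ps :: "('i \<times> complex poly) list"
    using that
  proof (induction ps arbitrary: L)
    case Nil
    then show ?case using free_functional_centered_product[of L] by simp
  next
    case (Cons x ps)
    obtain i p where x: "x = (i, p)" by (cases x)
    let ?P = "prod_list (map (\<lambda>(i, p). nc_eval p (nc_var i)) ps)"
    have "centered_product L * prod_list (map (\<lambda>(i, p). nc_eval p (nc_var i)) (x # ps)) =
        centered_product L * (\<Sum>k=1..degree p. nc_const (coeff p k) * centered_power i k) * ?P"
      using nc_eval_centered[of p i] Cons.prems(4) by (simp add: x mult.assoc)
    also have "\<dots> = (\<Sum>k=1..degree p. nc_const (coeff p k) * (centered_product (L @ [(i, k)]) * ?P))"
      unfolding sum_distrib_left sum_distrib_right
    proof (intro sum.cong refl)
      fix k
      have "centered_product (L @ [(i, k)]) = centered_product L * centered_power i k"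
        by (simp add: centered_product_def)
      then show "centered_product L * (nc_const (coeff p k) * centered_power i k) * ?P =
          nc_const (coeff p k) * (centered_product (L @ [(i, k)]) * ?P)"
        by (simp only: nc_const_commute[of "centered_product L"] mult.assoc[symmetric])
    qed
    finally have "free_functional (centered_product L * prod_list (map (\<lambda>(i, p). nc_eval p (nc_var i)) (x # ps)))
      = (\<Sum>k=1..degree p. coeff p k * free_functional (centered_product (L @ [(i, k)]) * ?P))"
      by (simp only: unital_functional_linear[OF free_functional_unital])
    also have "\<dots> = 0"
    proof (intro sum.neutral ballI)
      fix k assume k: "k \<in> {1..degree p}"
      have "free_functional (centered_product (L @ [(i, k)]) * ?P) = 0"
        by (rule Cons.IH) (use Cons.prems k in \<open>auto simp: x\<close>)
      then show "coeff p k * free_functional (centered_product (L @ [(i, k)]) * ?P) = 0" by simp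
    qed
    finally show ?case .
  qed
  from this[of "[]"] show ?thesis
    unfolding free_variables_def by (auto simp: centered_product_def)
qed

lemma free_functional_exists:
  "\<exists>\<tau>. unital_functional \<tau> \<and> free_variables \<tau> \<and> (\<forall>i k. \<tau> (nc_var i ^ k) = m i k)"
  using free_functional_unital free_functional_free free_functional_power by blast

end

section \<open>Lagrange inversion\<close>

text \<open>
  For \<open>j > 0\<close>, the series \<open>j \<phi>\<^sup>j (1 - t \<phi>' / \<phi>)\<close> equals \<open>j \<phi>\<^sup>j - t (\<phi>\<^sup>j)'\<close>, whose coefficient of \<open>t\<^sup>j\<close> vanishes.
\<close>

lemma lagrange_kronecker:
  fixes \<phi> :: "complex fps"
  assumes "\<phi> $ 0 \<noteq> 0"
  shows "(\<phi> ^ j * (1 - fps_X * fps_deriv \<phi> * inverse \<phi>)) $ j = (if j = 0 then 1 else 0)"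
proof (cases j)
  case (Suc i)
  have "of_nat j * (\<phi> ^ j * (1 - fps_X * fps_deriv \<phi> * inverse \<phi>))
      = of_nat j * \<phi> ^ j - fps_X * (of_nat j * \<phi> ^ i * fps_deriv \<phi>) * (\<phi> * inverse \<phi>)"
    by (simp add: Suc algebra_simps)
  also have "\<phi> * inverse \<phi> = 1"
    using inverse_mult_eq_1[OF assms] by (simp add: mult.commute)
  also have "of_nat j * \<phi> ^ i * fps_deriv \<phi> = fps_deriv (\<phi> ^ j)"
    using fps_deriv_power'[of \<phi> j] by (simp add: Suc mult_ac del: power_Suc of_nat_Suc)
  finally have eq: "of_nat j * (\<phi> ^ j * (1 - fps_X * fps_deriv \<phi> * inverse \<phi>))
      = of_nat j * \<phi> ^ j - fps_X * fps_deriv (\<phi> ^ j)" by simp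
  have "(of_nat j * (\<phi> ^ j * (1 - fps_X * fps_deriv \<phi> * inverse \<phi>))) $ j = 0"
    unfolding eq by (simp add: Suc fps_mult_of_nat_nth del: power_Suc of_nat_Suc)
  then show ?thesis by (simp add: Suc fps_mult_of_nat_nth del: of_nat_Suc)
qed simp

text \<open>
  The form of Lagrange inversion used here: if \<open>g \<phi> = t\<close> and \<open>N \<circ> g = H\<close>, then the coefficients
  of \<open>N\<close> are \<open>[t\<^sup>n] H \<phi>\<^sup>n (1 - t \<phi>' / \<phi>)\<close>.
\<close>

lemma lagrange_coefficient:
  fixes \<phi> g N :: "complex fps"
  assumes \<phi>: "\<phi> $ 0 \<noteq> 0" and g: "g * \<phi> = fps_X"
  shows "N $ n = ((N oo g) * \<phi> ^ n * (1 - fps_X * fps_deriv \<phi> * inverse \<phi>)) $ n"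
proof -
  let ?\<psi> = "1 - fps_X * fps_deriv \<phi> * inverse \<phi>"
  have "g $ 0 * \<phi> $ 0 = 0" using arg_cong[OF g, of "\<lambda>f. f $ 0"] by simp
  then have g0: "g $ 0 = 0" using \<phi> by simp
  have compose: "(N oo g) $ i = (\<Sum>k\<le>n. fps_const (N $ k) * g ^ k) $ i" if "i \<le> n" for i
  proof -
    have "(N oo g) $ i = (\<Sum>k=0..i. N $ k * (g ^ k) $ i)" by (simp add: fps_compose_nth)
    also have "\<dots> = (\<Sum>k\<le>n. N $ k * (g ^ k) $ i)"
      using that startsby_zero_power_prefix[OF g0] by (intro sum.mono_neutral_left) auto
    finally show ?thesis by (simp add: fps_sum_nth)
  qed
  have "((N oo g) * (\<phi> ^ n * ?\<psi>)) $ n = ((\<Sum>k\<le>n. fps_const (N $ k) * g ^ k) * (\<phi> ^ n * ?\<psi>)) $ n"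
    unfolding fps_mult_nth[of "N oo g"] fps_mult_nth[of "\<Sum>k\<le>n. fps_const (N $ k) * g ^ k"]
    by (intro sum.cong refl) (simp add: compose)
  also have "\<dots> = (\<Sum>k\<le>n. N $ k * (g ^ k * (\<phi> ^ n * ?\<psi>)) $ n)"
    by (simp add: sum_distrib_right fps_sum_nth mult.assoc)
  also have "\<dots> = (\<Sum>k\<le>n. N $ k * (if k = n then 1 else 0))"
  proof (intro sum.cong refl)
    fix k assume "k \<in> {..n}"
    then have k: "k \<le> n" by simp
    have "g ^ k * \<phi> ^ n = (g * \<phi>) ^ k * \<phi> ^ (n - k)"
      using power_add[of \<phi> k "n - k"] k by (simp add: power_mult_distrib mult.assoc)
    then have eq: "g ^ k * (\<phi> ^ n * ?\<psi>) = fps_X ^ k * (\<phi> ^ (n - k) * ?\<psi>)"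
      by (simp only: g mult.assoc[symmetric])
    have "(g ^ k * (\<phi> ^ n * ?\<psi>)) $ n = (\<phi> ^ (n - k) * ?\<psi>) $ (n - k)"
      unfolding eq using k by (simp add: fps_X_power_mult_nth)
    then show "N $ k * (g ^ k * (\<phi> ^ n * ?\<psi>)) $ n = N $ k * (if k = n then 1 else 0)"
      using k by (simp only: lagrange_kronecker[OF \<phi>]) simp
  qed
  also have "\<dots> = (\<Sum>k\<le>n. if k = n then N $ k else 0)"
    by (intro sum.cong refl) simp
  also have "\<dots> = N $ n" by simp
  finally show ?thesis by (simp add: mult.assoc)
qed

lemma lagrange_inversion:
  fixes \<phi> g M H :: "complex fps"
  assumes \<phi>: "\<phi> $ 0 \<noteq> 0" and g: "g * \<phi> = fps_X"
    and M: "\<And>n. M $ n = (H * \<phi> ^ n * (1 - fps_X * fps_deriv \<phi> * inverse \<phi>)) $ n"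
  shows "M oo g = H"
proof -
  have "g $ 0 * \<phi> $ 0 = 0" using arg_cong[OF g, of "\<lambda>f. f $ 0"] by simp
  then have g0: "g $ 0 = 0" using \<phi> by simp
  moreover have "(g * \<phi>) $ 1 = 1" by (simp add: g)
  ultimately have g1: "g $ 1 \<noteq> 0" by (auto simp: fps_mult_nth)
  have N: "fps_ginv H g oo g = H" by (rule fps_ginv[OF g0 g1])
  have "M = fps_ginv H g"
    by (rule fps_ext) (simp add: M lagrange_coefficient[OF \<phi> g, of "fps_ginv H g"] N)
  then show ?thesis using N by simp
qed

text \<open>
  The inverse for the \<open>r\<close>-th power of the arcsine distribution: \<open>t / (1 + t)\<close> times the S-transform
  \<open>((2 + t) / (1 + t))\<^sup>r\<close>.
\<close>

definition raney_inverse :: "nat \<Rightarrow> complex fps" where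
  "raney_inverse r = fps_X * (2 + fps_X) ^ r * inverse (1 + fps_X) ^ (r + 1)"

lemma fps_one_plus_X_inverse: "(1 + fps_X) * inverse (1 + fps_X :: complex fps) = 1"
  using inverse_mult_eq_1[of "1 + fps_X :: complex fps"] by (simp add: mult.commute)

lemma raney_inverse_nth_0: "raney_inverse r $ 0 = 0"
  by (simp add: raney_inverse_def)

lemma raney_inverse_nth_1: "raney_inverse r $ 1 \<noteq> 0"
proof -
  have "raney_inverse r $ 1 = ((2 + fps_X) ^ r * inverse (1 + fps_X) ^ (r + 1) :: complex fps) $ 0"
    unfolding raney_inverse_def mult.assoc by simp
  also have "\<dots> = 2 ^ r" by (simp add: fps_power_zeroth)
  finally show ?thesis by simp
qed

lemma raney_inverse_Suc:
  "fps_X * raney_inverse (Suc r) = raney_inverse r * raney_inverse 1 * (1 + fps_X)"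
proof -
  have "raney_inverse r * raney_inverse 1 * (1 + fps_X) = fps_X * (fps_X * (2 + fps_X) ^ Suc r
      * inverse (1 + fps_X) ^ (r + 2)) * ((1 + fps_X) * inverse (1 + fps_X))"
    by (simp add: raney_inverse_def algebra_simps power_add)
  then show ?thesis
    unfolding fps_one_plus_X_inverse by (simp add: raney_inverse_def)
qed

text \<open>
  Lagrange inversion for \<open>\<phi> = (1 + u)\<^sup>r\<^sup>+\<^sup>1 / 2\<^sup>r\<^sup>+\<^sup>1\<close> and \<open>H = (1 + u) / (1 - u)\<close>, followed by the
  substitution \<open>u = t / (2 + t)\<close>. Here \<open>H (1 - u \<phi>' / \<phi>) = (1 - r u) / (1 - u)\<close>.
\<close>

lemma raney_moment_series:
  fixes M :: "complex fps"
  assumes M: "\<And>n. M $ n = ((1 + fps_X) ^ ((r + 1) * n) * (1 - of_nat r * fps_X) * inverse (1 - fps_X)) $ n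
      / 2 ^ ((r + 1) * n)"
  shows "M oo raney_inverse r = 1 + fps_X"
proof -
  define k where "k = fps_const (1 / 2 ^ (r + 1) :: complex)"
  define \<phi> where "\<phi> = k * (1 + fps_X) ^ (r + 1)"
  define H where "H = (1 + fps_X) * inverse (1 - fps_X :: complex fps)"
  define g where "g = fps_X * inverse \<phi>"
  define u where "u = fps_X * inverse (2 + fps_X :: complex fps)"
  have \<phi>0: "\<phi> $ 0 \<noteq> 0" by (simp add: \<phi>_def k_def fps_power_zeroth)
  have \<phi>_inv: "inverse \<phi> * \<phi> = 1" by (rule inverse_mult_eq_1[OF \<phi>0])
  have g: "g * \<phi> = fps_X" using \<phi>_inv by (simp add: g_def mult.assoc)
  have H: "H * (1 - fps_X) = 1 + fps_X"
    using inverse_mult_eq_1[of "1 - fps_X :: complex fps"] by (simp add: H_def mult.assoc)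
  have "(1 - fps_X * fps_deriv \<phi> * inverse \<phi>) * (1 + fps_X) = 1 - of_nat r * fps_X"
  proof -
    have "fps_deriv \<phi> * (1 + fps_X) = of_nat (r + 1) * \<phi>"
    proof -
      have d: "fps_deriv ((1 + fps_X :: complex fps) ^ (r + 1)) = of_nat (r + 1) * (1 + fps_X) ^ r"
        by (simp add: fps_deriv_power' del: power_Suc of_nat_Suc)
      have "fps_deriv \<phi> = k * fps_deriv ((1 + fps_X) ^ (r + 1))"
        by (simp add: \<phi>_def k_def del: power_Suc)
      then show ?thesis unfolding d by (simp add: \<phi>_def mult_ac del: of_nat_Suc)
    qed
    then have "(fps_deriv \<phi> * (1 + fps_X)) * inverse \<phi> = of_nat (r + 1)"
      using \<phi>_inv by (simp add: mult.assoc mult.commute[of \<phi>])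
    then have "fps_X * ((fps_deriv \<phi> * (1 + fps_X)) * inverse \<phi>) = of_nat (r + 1) * fps_X"
      by (simp only: mult.commute)
    then have "fps_X * fps_deriv \<phi> * inverse \<phi> * (1 + fps_X) = of_nat (r + 1) * fps_X"
      by (simp only: mult_ac)
    then show ?thesis by (simp add: left_diff_distrib) (simp add: algebra_simps)
  qed
  then have "(1 - fps_X * fps_deriv \<phi> * inverse \<phi>) * (1 + fps_X) * inverse (1 - fps_X)
      = (1 - of_nat r * fps_X) * inverse (1 - fps_X)" by (rule arg_cong)
  then have \<psi>: "H * (1 - fps_X * fps_deriv \<phi> * inverse \<phi>) = (1 - of_nat r * fps_X) * inverse (1 - fps_X)"
    unfolding H_def by (simp only: mult_ac)
  have "M $ n = (H * \<phi> ^ n * (1 - fps_X * fps_deriv \<phi> * inverse \<phi>)) $ n" for n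
  proof -
    have "H * \<phi> ^ n * (1 - fps_X * fps_deriv \<phi> * inverse \<phi>)
        = \<phi> ^ n * (H * (1 - fps_X * fps_deriv \<phi> * inverse \<phi>))" by (simp add: mult_ac)
    also have "\<dots> = fps_const (1 / 2 ^ ((r + 1) * n)) *
        ((1 + fps_X) ^ ((r + 1) * n) * (1 - of_nat r * fps_X) * inverse (1 - fps_X))"
      unfolding \<psi> by (simp only: \<phi>_def k_def power_mult_distrib fps_const_power power_mult
        power_divide power_one mult.assoc)
    finally show ?thesis using M[of n] by simp
  qed
  then have Mg: "M oo g = H" by (rule lagrange_inversion[OF \<phi>0 g])
  have u0: "u $ 0 = 0" by (simp add: u_def)
  have g0: "g $ 0 = 0" by (simp add: g_def)
  have u: "u * (2 + fps_X) = fps_X"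
    using inverse_mult_eq_1[of "2 + fps_X :: complex fps"] by (simp add: u_def mult.assoc)
  then have u1: "(1 + u) * (2 + fps_X) = 2 * (1 + fps_X)" "(1 - u) * (2 + fps_X) = 2"
    by (simp_all add: algebra_simps)
  have Hu: "H oo u = 1 + fps_X"
  proof -
    have "(H oo u) * (1 - u) = 1 + u"
      using arg_cong[OF H, of "\<lambda>f. f oo u"] u0
      by (simp add: fps_compose_mult_distrib fps_compose_sub_distrib fps_compose_add_distrib)
    then have "(H oo u) * ((1 - u) * (2 + fps_X)) = (1 + u) * (2 + fps_X)"
      by (simp flip: mult.assoc)
    then have "(H oo u) * 2 = (1 + fps_X) * 2" unfolding u1 by (simp add: mult.commute)
    then show ?thesis by (metis mult_right_cancel zero_neq_numeral)
  qed
  have gu: "g oo u = raney_inverse r"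
  proof -
    have "(g oo u) * (fps_const (1 / 2 ^ (r + 1)) * (1 + u) ^ (r + 1)) = u"
      using arg_cong[OF g, of "\<lambda>f. f oo u"] u0
      by (simp add: fps_compose_mult_distrib fps_compose_add_distrib \<phi>_def k_def fps_compose_power[OF u0, symmetric])
    then have "(g oo u) * (fps_const (1 / 2 ^ (r + 1)) * (1 + u) ^ (r + 1)) * (2 + fps_X) ^ (r + 1)
        = u * (2 + fps_X) ^ (r + 1)" by simp
    then have "(g oo u) * (fps_const (1 / 2 ^ (r + 1)) * ((1 + u) * (2 + fps_X)) ^ (r + 1))
        = (u * (2 + fps_X)) * (2 + fps_X) ^ r"
      by (simp add: power_mult_distrib mult_ac)
    moreover have "fps_const (1 / 2 ^ (r + 1)) * (2 * (1 + fps_X)) ^ (r + 1) = (1 + fps_X :: complex fps) ^ (r + 1)"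
    proof -
      have "(2 :: complex fps) ^ (r + 1) = fps_const (2 ^ (r + 1))"
        by (simp only: fps_numeral_fps_const fps_const_power)
      then show ?thesis
        by (simp only: power_mult_distrib mult.assoc[symmetric] fps_const_mult) simp
    qed
    ultimately have "(g oo u) * (1 + fps_X) ^ (r + 1) = fps_X * (2 + fps_X) ^ r"
      by (simp only: u1 u)
    then have "(g oo u) * ((1 + fps_X) ^ (r + 1) * inverse (1 + fps_X) ^ (r + 1)) = raney_inverse r"
      unfolding raney_inverse_def by (simp only: mult.assoc[symmetric])
    then show ?thesis
      by (simp only: power_mult_distrib[symmetric] fps_one_plus_X_inverse power_one mult_1_right)
  qed
  have "M oo raney_inverse r = (M oo g) oo u"
    unfolding gu[symmetric] using fps_compose_assoc[OF u0 g0, of M] .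
  then show ?thesis using Mg Hu by simp
qed

text \<open>A moment series is determined by any inverse with nonzero linear coefficient.\<close>

lemma fps_compose_cancel:
  fixes M N h :: "complex fps"
  assumes "M oo h = N oo h" "h $ 0 = 0" "h $ 1 \<noteq> 0"
  shows "M = N"
proof -
  have "(M oo h) oo fps_inv h = (N oo h) oo fps_inv h" using assms(1) by simp
  moreover have "(K oo h) oo fps_inv h = K" for K
  proof -
    have "(K oo h) oo fps_inv h = K oo (h oo fps_inv h)"
      by (rule fps_compose_assoc[symmetric]) (simp_all add: assms fps_inv_def)
    then show ?thesis using fps_inv_right[OF assms(2,3)] by simp
  qed
  ultimately show ?thesis by simp
qed

section \<open>The boundary curve\<close>

locale raney =
  fixes r :: nat
  assumes r: "r \<ge> 1"
begin

text \<open>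
  The right end of the parameter interval, the parametrization \<open>x(\<phi>)\<close> of the spectrum, the density
  at \<open>x(\<phi>)\<close>, and the right end of the support.
\<close>

definition angle_max :: real where "angle_max = pi / (real r + 1)"

definition spectral_var :: "real \<Rightarrow> real" where
  "spectral_var \<phi> = sin ((real r + 1) * \<phi>) ^ (r + 1) / (2 ^ (r + 1) * sin \<phi> * sin (real r * \<phi>) ^ r)"

definition spectral_density :: "real \<Rightarrow> real" where
  "spectral_density \<phi> = 2 ^ (r + 2) * (sin \<phi>)\<^sup>2 * sin (real r * \<phi>) ^ (r + 1) /
     (pi * sin ((real r + 1) * \<phi>) ^ r *
       (4 * (sin \<phi>)\<^sup>2 * (sin (real r * \<phi>))\<^sup>2 + (sin ((real r - 1) * \<phi>))\<^sup>2))"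

definition spectral_max :: real where
  "spectral_max = (real r + 1) ^ (r + 1) / (2 ^ (r + 1) * real r ^ r)"

text \<open>
  The curve in the upper half-plane on which the rational function \<open>x = (1 + u)\<^sup>r\<^sup>+\<^sup>1 / (2\<^sup>r\<^sup>+\<^sup>1 u)\<close> is
  real. The polar angle of \<open>u(\<phi>)\<close> is \<open>(r + 1) \<phi>\<close>.
\<close>

definition curve :: "real \<Rightarrow> complex" where
  "curve \<phi> = of_real (sin \<phi> / sin (real r * \<phi>)) * cis ((real r + 1) * \<phi>)"

definition spectral_map :: "complex \<Rightarrow> complex" where
  "spectral_map u = (1 + u) ^ (r + 1) / (2 ^ (r + 1) * u)"

lemma angle_max_pos: "angle_max > 0"
  by (simp add: angle_max_def add_nonneg_pos)

lemma sin_pos: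
  assumes "0 < \<phi>" "\<phi> < angle_max"
  shows "sin \<phi> > 0" "sin (real r * \<phi>) > 0" "sin ((real r + 1) * \<phi>) > 0" "(real r + 1) * \<phi> < pi"
proof -
  have l: "(real r + 1) * \<phi> < pi"
    using assms(2) by (simp add: angle_max_def field_simps)
  have le: "\<phi> \<le> real r * \<phi>" "real r * \<phi> < (real r + 1) * \<phi>" using r assms(1) by simp_all
  have lt: "\<phi> < pi" "real r * \<phi> < pi" using l le by linarith+
  have "real r * \<phi> > 0" "(real r + 1) * \<phi> > 0" using r assms(1) by simp_all
  then show "sin \<phi> > 0" "sin (real r * \<phi>) > 0" "sin ((real r + 1) * \<phi>) > 0"
    using assms(1) l lt by (auto intro!: sin_gt_zero)
  show "(real r + 1) * \<phi> < pi" by (fact l)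
qed

lemma sin_cos_Suc:
  "sin ((real r + 1) * \<phi>) = sin \<phi> * cos (real r * \<phi>) + cos \<phi> * sin (real r * \<phi>)"
  "cos ((real r + 1) * \<phi>) = cos \<phi> * cos (real r * \<phi>) - sin \<phi> * sin (real r * \<phi>)"
  "sin ((real r - 1) * \<phi>) = sin (real r * \<phi>) * cos \<phi> - cos (real r * \<phi>) * sin \<phi>"
  by (simp_all add: distrib_right left_diff_distrib sin_add cos_add sin_diff)

lemma Im_curve: "Im (curve \<phi>) = sin \<phi> / sin (real r * \<phi>) * sin ((real r + 1) * \<phi>)"
  and Re_curve: "Re (curve \<phi>) = sin \<phi> / sin (real r * \<phi>) * cos ((real r + 1) * \<phi>)"
  by (simp_all add: curve_def)

context
  fixes \<phi> :: real
  assumes \<phi>: "0 < \<phi>" "\<phi> < angle_max"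
begin

lemma Im_curve_pos: "Im (curve \<phi>) > 0"
  using sin_pos[OF \<phi>] by (simp add: Im_curve)

lemma curve_neq: "curve \<phi> \<noteq> 0" "1 + curve \<phi> \<noteq> 0" "1 - curve \<phi> \<noteq> 0"
  using Im_curve_pos by (auto simp: complex_eq_iff)

lemma one_plus_curve: "1 + curve \<phi> = of_real (sin ((real r + 1) * \<phi>) / sin (real r * \<phi>)) * cis \<phi>"
proof (rule complex_eqI)
  define s S c c' where "s = sin \<phi>" and "S = sin (real r * \<phi>)" and "c = cos \<phi>" and "c' = cos (real r * \<phi>)"
  have S: "S \<noteq> 0" using sin_pos[OF \<phi>] by (simp add: S_def)
  have "s\<^sup>2 + c\<^sup>2 = 1" by (simp add: s_def c_def)
  then have "S + s * (c * c' - s * S) = (s * c' + c * S) * c" by algebra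
  then have "1 + s / S * (c * c' - s * S) = (s * c' + c * S) / S * c"
    using S by (simp add: divide_simps)
  then show "Re (1 + curve \<phi>) = Re (of_real (sin ((real r + 1) * \<phi>) / sin (real r * \<phi>)) * cis \<phi>)"
    by (simp add: Re_curve sin_cos_Suc s_def S_def c_def c'_def)
  show "Im (1 + curve \<phi>) = Im (of_real (sin ((real r + 1) * \<phi>) / sin (real r * \<phi>)) * cis \<phi>)"
    by (simp add: Im_curve)
qed

lemma spectral_map_curve: "spectral_map (curve \<phi>) = of_real (spectral_var \<phi>)"
proof -
  have pos: "sin \<phi> \<noteq> 0" "sin (real r * \<phi>) \<noteq> 0" using sin_pos[OF \<phi>] by simp_all
  have "(1 + curve \<phi>) ^ (r + 1) =
      of_real ((sin ((real r + 1) * \<phi>) / sin (real r * \<phi>)) ^ (r + 1)) * cis ((real r + 1) * \<phi>)"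
    unfolding one_plus_curve power_mult_distrib Complex.DeMoivre by simp (simp add: algebra_simps)
  then have "spectral_map (curve \<phi>) = of_real ((sin ((real r + 1) * \<phi>) / sin (real r * \<phi>)) ^ (r + 1) /
      (2 ^ (r + 1) * (sin \<phi> / sin (real r * \<phi>))))"
    by (simp add: spectral_map_def curve_def)
  also have "(sin ((real r + 1) * \<phi>) / sin (real r * \<phi>)) ^ (r + 1) /
      (2 ^ (r + 1) * (sin \<phi> / sin (real r * \<phi>))) = spectral_var \<phi>"
    using pos by (simp add: spectral_var_def power_divide)
  finally show ?thesis .
qed

lemma spectral_var_pos: "spectral_var \<phi> > 0"
  using sin_pos[OF \<phi>] by (simp add: spectral_var_def)

end

context
  fixes \<phi> :: real
  assumes \<phi>: "0 < \<phi>" "\<phi> < angle_max"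
begin

lemma spectral_density_pos: "spectral_density \<phi> > 0"
proof -
  have "4 * (sin \<phi>)\<^sup>2 * (sin (real r * \<phi>))\<^sup>2 + (sin ((real r - 1) * \<phi>))\<^sup>2 > 0"
    using sin_pos[OF \<phi>] by (intro add_pos_nonneg) auto
  then show ?thesis using sin_pos[OF \<phi>] by (simp add: spectral_density_def)
qed

text \<open>
  Stieltjes inversion: on the curve, \<open>(1 + u) / (1 - u)\<close> is the boundary value of the moment
  generating function at \<open>1 / x\<close>.
\<close>

lemma spectral_density_Im: "pi * spectral_var \<phi> * spectral_density \<phi> = Im ((1 + curve \<phi>) / (1 - curve \<phi>))"
proof -
  define s S C where "s = sin \<phi>" and "S = sin (real r * \<phi>)" and "C = sin ((real r + 1) * \<phi>)"
  have pos: "s > 0" "S > 0" "C > 0" using sin_pos[OF \<phi>] by (simp_all add: s_def S_def C_def)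
  define K where "K = 4 * s\<^sup>2 * S\<^sup>2 + (sin ((real r - 1) * \<phi>))\<^sup>2"
  have K: "K > 0" unfolding K_def using pos by (intro add_pos_nonneg) auto
  have "pi * spectral_var \<phi> * spectral_density \<phi> =
      pi * (C ^ (r + 1) / (2 ^ (r + 1) * s * S ^ r)) * (2 ^ (r + 2) * s\<^sup>2 * S ^ (r + 1) / (pi * C ^ r * K))"
    by (simp add: spectral_var_def spectral_density_def s_def S_def C_def K_def)
  also have "\<dots> = 2 * s * S * C / K"
    using pos K by (simp add: divide_simps power2_eq_square)
  finally have lhs: "pi * spectral_var \<phi> * spectral_density \<phi> = 2 * s * S * C / K" .
  have "Im ((1 + curve \<phi>) / (1 - curve \<phi>)) = 2 * Im (curve \<phi>) / ((1 - Re (curve \<phi>))\<^sup>2 + (Im (curve \<phi>))\<^sup>2)"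
    by (simp add: Im_divide algebra_simps)
  moreover have "S\<^sup>2 * ((1 - Re (curve \<phi>))\<^sup>2 + (Im (curve \<phi>))\<^sup>2) = K"
  proof -
    define c c' where "c = cos \<phi>" and "c' = cos (real r * \<phi>)"
    have sq: "s\<^sup>2 + c\<^sup>2 = 1" "S\<^sup>2 + c'\<^sup>2 = 1" by (simp_all add: s_def S_def c_def c'_def)
    have "S\<^sup>2 * ((1 - Re (curve \<phi>))\<^sup>2 + (Im (curve \<phi>))\<^sup>2) =
        (S - s * cos ((real r + 1) * \<phi>))\<^sup>2 + (s * sin ((real r + 1) * \<phi>))\<^sup>2"
      using pos unfolding Re_curve Im_curve s_def[symmetric] S_def[symmetric]
      by (simp add: power_divide power_mult_distrib field_simps power2_eq_square)
    also have "\<dots> = (S - s * (c * c' - s * S))\<^sup>2 + (s * (s * c' + c * S))\<^sup>2"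
      by (simp only: sin_cos_Suc s_def S_def c_def c'_def)
    also have "\<dots> = 4 * s\<^sup>2 * S\<^sup>2 + (S * c - c' * s)\<^sup>2"
      using sq by algebra
    also have "\<dots> = K" by (simp only: K_def sin_cos_Suc s_def S_def c_def c'_def)
    finally show ?thesis .
  qed
  moreover have "Im (curve \<phi>) = s * C / S" by (simp add: Im_curve s_def S_def C_def)
  ultimately have "Im ((1 + curve \<phi>) / (1 - curve \<phi>)) = 2 * (s * C / S) / (K / S\<^sup>2)"
    using pos by (metis nonzero_mult_div_cancel_left power2_eq_square mult_eq_0_iff less_numeral_extra(3))
  also have "\<dots> = 2 * s * S * C / K" using pos K by (simp add: field_simps power2_eq_square)
  finally show ?thesis using lhs by simp
qed

text \<open>The logarithmic derivative of the curve, \<open>u' / u = cot \<phi> - r cot (r \<phi>) + i (r + 1)\<close>.\<close>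

definition curve_slope :: complex where
  "curve_slope = Complex (cos \<phi> / sin \<phi> - real r * cos (real r * \<phi>) / sin (real r * \<phi>)) (real r + 1)"

lemma curve_deriv: "(curve has_vector_derivative curve \<phi> * curve_slope) (at \<phi>)"
proof -
  have pos: "sin \<phi> \<noteq> 0" "sin (real r * \<phi>) \<noteq> 0" using sin_pos[OF \<phi>] by simp_all
  define k \<kappa> where "k = sin \<phi> / sin (real r * \<phi>)"
    and "\<kappa> = cos \<phi> / sin \<phi> - real r * cos (real r * \<phi>) / sin (real r * \<phi>)"
  have 1: "((\<lambda>\<phi>. sin \<phi> / sin (real r * \<phi>)) has_real_derivative k * \<kappa>) (at \<phi>)"
    using pos by (auto intro!: derivative_eq_intros simp: k_def \<kappa>_def field_simps)
  have 2: "((\<lambda>\<phi>. cos ((real r + 1) * \<phi>)) has_real_derivative - sin ((real r + 1) * \<phi>) * (real r + 1)) (at \<phi>)"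
    "((\<lambda>\<phi>. sin ((real r + 1) * \<phi>)) has_real_derivative cos ((real r + 1) * \<phi>) * (real r + 1)) (at \<phi>)"
    by (auto intro!: derivative_eq_intros)
  have "Re (curve \<phi> * curve_slope) = k * \<kappa> * cos ((real r + 1) * \<phi>)
      + - sin ((real r + 1) * \<phi>) * (real r + 1) * k"
    "Im (curve \<phi> * curve_slope) = k * \<kappa> * sin ((real r + 1) * \<phi>)
      + cos ((real r + 1) * \<phi>) * (real r + 1) * k"
    unfolding times_complex.sel Re_curve Im_curve curve_slope_def complex.sel
      k_def[symmetric] \<kappa>_def[symmetric] by algebra+
  then show ?thesis
    unfolding has_vector_derivative_complex_iff Re_curve Im_curve
    using DERIV_mult[OF 1 2(1)] DERIV_mult[OF 1 2(2)] by (simp add: k_def)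
qed

text \<open>
  The derivative of \<open>x(\<phi>)\<close>, computed by the chain rule from \<open>x(\<phi>) = (1 + u)\<^sup>r\<^sup>+\<^sup>1 / (2\<^sup>r\<^sup>+\<^sup>1 u)\<close>. The
  expression under the real part is in fact real.
\<close>

definition spectral_slope :: real where
  "spectral_slope = Re (of_real (spectral_var \<phi>) *
     ((of_nat (r + 1) / (1 + curve \<phi>) - 1 / curve \<phi>) * (curve \<phi> * curve_slope)))"

lemma spectral_map_deriv:
  assumes "u \<noteq> 0" "1 + u \<noteq> 0"
  shows "(spectral_map has_field_derivative spectral_map u * (of_nat (r + 1) / (1 + u) - 1 / u)) (at u)"
proof -
  define c :: complex where "c = 2 ^ (r + 1)"
  define n :: complex where "n = of_nat (r + 1)"
  have c: "c \<noteq> 0" by (simp add: c_def)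
  have "((\<lambda>u. 1 + u) has_field_derivative (1 :: complex)) (at u)"
    by (auto intro!: derivative_eq_intros)
  from DERIV_power[OF this, of "r + 1"]
  have 1: "((\<lambda>u. (1 + u) ^ (r + 1)) has_field_derivative n * (1 + u) ^ r) (at u)"
    by (simp add: n_def)
  have 2: "((\<lambda>u. c * u) has_field_derivative c) (at u)"
    by (auto intro!: derivative_eq_intros)
  have alg: "(n * P * (c * u) - P * w * c) / ((c * u) * (c * u)) = P * w / (c * u) * (n / w - 1 / u)"
    if "w \<noteq> 0" for P w :: complex
    using that assms(1) c by (simp add: divide_simps) algebra
  have "((\<lambda>u. (1 + u) ^ (r + 1) / (c * u)) has_field_derivative
      (n * (1 + u) ^ r * (c * u) - (1 + u) ^ r * (1 + u) * c) / ((c * u) * (c * u))) (at u)"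
    using DERIV_divide[OF 1 2] assms(1) c by (simp add: mult_ac)
  then show ?thesis
    unfolding alg[OF assms(2)] by (simp add: spectral_map_def[abs_def] c_def n_def mult_ac)
qed

text \<open>
  The spectral variable decreases along the curve: with \<open>q = r - (r + 1) / (1 + u)\<close> the number
  \<open>q u' / u = x' / x\<close> is real, while \<open>q\<close> and \<open>u' / u\<close> both have positive imaginary part.
\<close>

lemma spectral_var_deriv:
  "(spectral_var has_real_derivative spectral_slope) (at \<phi>)"
  "of_real spectral_slope = of_real (spectral_var \<phi>) *
     ((of_nat (r + 1) / (1 + curve \<phi>) - 1 / curve \<phi>) * (curve \<phi> * curve_slope))"
  "spectral_slope < 0"
proof -
  define D where "D = of_real (spectral_var \<phi>) *
     ((of_nat (r + 1) / (1 + curve \<phi>) - 1 / curve \<phi>) * (curve \<phi> * curve_slope))"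
  have "((spectral_map \<circ> curve) has_vector_derivative D) (at \<phi>)"
    using field_vector_diff_chain_at[OF curve_deriv spectral_map_deriv[OF curve_neq(1,2)[OF \<phi>]]]
    by (simp add: D_def spectral_map_curve[OF \<phi>] mult_ac)
  moreover have ev: "\<forall>\<^sub>F \<theta> in nhds \<phi>. (spectral_map \<circ> curve) \<theta> = of_real (spectral_var \<theta>)"
  proof -
    have "\<forall>\<^sub>F \<theta> in nhds \<phi>. \<theta> \<in> {0<..<angle_max}"
      using \<phi> by (intro eventually_nhds_in_open) auto
    then show ?thesis by eventually_elim (simp add: spectral_map_curve)
  qed
  ultimately have *: "((\<lambda>\<theta>. of_real (spectral_var \<theta>)) has_vector_derivative D) (at \<phi>)"
    using has_vector_derivative_cong_ev[of UNIV "spectral_map \<circ> curve" "\<lambda>\<theta>. of_real (spectral_var \<theta>)" \<phi> D]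
      eventually_nhds_x_imp_x[OF ev] by simp
  have "((\<lambda>\<theta>. Re (complex_of_real (spectral_var \<theta>))) has_real_derivative Re D) (at \<phi>)"
    by (rule has_field_derivative_Re[OF *])
  then show deriv: "(spectral_var has_real_derivative spectral_slope) (at \<phi>)"
    by (simp add: D_def spectral_slope_def)
  have "((\<lambda>\<theta>. Im (complex_of_real (spectral_var \<theta>))) has_real_derivative Im D) (at \<phi>)"
    by (rule has_field_derivative_Im[OF *])
  then have "((\<lambda>\<theta>. 0) has_real_derivative Im D) (at \<phi>)" by simp
  then have "Im D = 0" using DERIV_unique DERIV_const by blast
  then have D: "of_real spectral_slope = D"
    by (simp add: complex_eq_iff spectral_slope_def D_def)
  then show "of_real spectral_slope = of_real (spectral_var \<phi>) *
     ((of_nat (r + 1) / (1 + curve \<phi>) - 1 / curve \<phi>) * (curve \<phi> * curve_slope))"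
    by (simp only: D_def)
  define l where "l = spectral_slope / spectral_var \<phi>"
  define q where "q = of_nat (r + 1) / (1 + curve \<phi>) * curve \<phi> - 1"
  have x: "spectral_var \<phi> > 0" by (rule spectral_var_pos[OF \<phi>])
  have "D = of_real (spectral_var \<phi>) * (q * curve_slope)"
    using curve_neq[OF \<phi>] by (simp add: D_def q_def left_diff_distrib right_diff_distrib mult.assoc)
  then have "q * curve_slope = of_real l"
    using D x by (simp add: l_def field_simps)
  then have "q * (curve_slope * cnj curve_slope) = of_real l * cnj curve_slope"
    by (simp flip: mult.assoc)
  then have "Im (q * of_real ((cmod curve_slope)\<^sup>2)) = Im (of_real l * cnj curve_slope)"
    by (simp only: complex_norm_square)
  then have l: "Im q * (cmod curve_slope)\<^sup>2 = - l * (real r + 1)"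
    by (simp add: curve_slope_def algebra_simps)
  have "q = of_nat r - of_nat (r + 1) / (1 + curve \<phi>)"
  proof -
    have "of_nat (r + 1) / (1 + curve \<phi>) * curve \<phi> =
        of_nat (r + 1) / (1 + curve \<phi>) * (1 + curve \<phi>) - of_nat (r + 1) / (1 + curve \<phi>)"
      by (simp only: distrib_left mult_1_right) simp
    then show ?thesis using curve_neq(2)[OF \<phi>] by (simp add: q_def)
  qed
  then have "Im q = real (r + 1) * Im (curve \<phi>) / (cmod (1 + curve \<phi>))\<^sup>2"
    by (simp add: Im_divide cmod_power2)
  then have "Im q > 0"
    using Im_curve_pos[OF \<phi>] curve_neq(2)[OF \<phi>] by (auto intro!: divide_pos_pos mult_pos_pos)
  moreover have "curve_slope \<noteq> 0" by (simp add: curve_slope_def complex_eq_iff)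
  ultimately have "Im q * (cmod curve_slope)\<^sup>2 > 0" by simp
  then have "l * (real r + 1) < 0" unfolding l by simp
  then have "l < 0" by (simp add: mult_less_0_iff)
  then show "spectral_slope < 0" using x by (simp add: l_def divide_less_0_iff)
qed

lemma Im_of_real_mult: "Im (of_real a * z) = a * Im z"
  by simp

text \<open>
  The complex integrand of the \<open>n\<close>-th moment. It arises from
  \<open>(1 + u) / (1 - u) \<cdot> x' / x = ((r - 1) / (1 - u) - 1 / u) u'\<close>; written in this way, the pole at \<open>1\<close>
  disappears in the case \<open>r = 1\<close>, where the curve starts at that pole.
\<close>

lemma moment_integrand_Im:
  "Im (spectral_map (curve \<phi>) ^ n * (of_real (real r - 1) / (1 - curve \<phi>) - 1 / curve \<phi>) * (curve \<phi> * curve_slope))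
     = pi * spectral_var \<phi> ^ n * spectral_density \<phi> * spectral_slope"
proof -
  define u w x where "u = curve \<phi>" and "w = curve \<phi> * curve_slope" and "x = spectral_var \<phi>"
  have x: "x > 0" using spectral_var_pos[OF \<phi>] by (simp add: x_def)
  have u: "u \<noteq> 0" "1 + u \<noteq> 0" "1 - u \<noteq> 0" using curve_neq[OF \<phi>] by (simp_all add: u_def)
  have eq: "of_real (real r - 1) / (1 - u) - 1 / u = (1 + u) / (1 - u) * (of_nat (r + 1) / (1 + u) - 1 / u)"
    using u by (simp add: divide_simps) (simp add: algebra_simps)
  have slope: "of_real spectral_slope = of_real x * ((of_nat (r + 1) / (1 + u) - 1 / u) * w)"
    using spectral_var_deriv(2) by (simp only: u_def w_def x_def)
  define A B where "A = (of_real (real r - 1) / (1 - u) - 1 / u) * w" and "B = (1 + u) / (1 - u)"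
  have "of_real x * A = B * of_real spectral_slope"
    unfolding A_def B_def eq slope by (simp only: mult_ac)
  then have "A = of_real (spectral_slope / x) * B"
    using x by (simp add: field_simps)
  then have "(of_real (real r - 1) / (1 - u) - 1 / u) * w = of_real (spectral_slope / x) * ((1 + u) / (1 - u))"
    by (simp only: A_def B_def)
  then have "spectral_map u ^ n * (of_real (real r - 1) / (1 - u) - 1 / u) * w =
      of_real (x ^ n * (spectral_slope / x)) * ((1 + u) / (1 - u))"
    using spectral_map_curve[OF \<phi>] by (simp add: u_def x_def mult.assoc)
  then have "Im (spectral_map u ^ n * (of_real (real r - 1) / (1 - u) - 1 / u) * w) =
      Im (of_real (x ^ n * (spectral_slope / x)) * ((1 + u) / (1 - u)))" by (simp only:)
  also have "\<dots> = x ^ n * (spectral_slope / x) * Im ((1 + u) / (1 - u))"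
    by (simp only: Im_of_real_mult)
  also have "Im ((1 + u) / (1 - u)) = pi * x * spectral_density \<phi>"
    using spectral_density_Im by (simp only: u_def x_def)
  finally have "Im (spectral_map u ^ n * (of_real (real r - 1) / (1 - u) - 1 / u) * w) =
      x ^ n * (spectral_slope / x) * (pi * x * spectral_density \<phi>)" .
  then show ?thesis using x by (simp add: u_def w_def x_def)
qed

end

end

section \<open>Primitives along the curve\<close>

context raney
begin

lemma curve_Ln: "0 < \<phi> \<Longrightarrow> \<phi> < angle_max \<Longrightarrow> Im (Ln (curve \<phi>)) = (real r + 1) * \<phi>"
proof -
  assume \<phi>: "0 < \<phi>" "\<phi> < angle_max"
  have pos: "sin \<phi> / sin (real r * \<phi>) > 0" using sin_pos[OF \<phi>] by simp
  define z where "z = Complex (ln (sin \<phi> / sin (real r * \<phi>))) ((real r + 1) * \<phi>)"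
  have "curve \<phi> = exp z"
    unfolding z_def exp_eq_polar curve_def using pos by simp
  moreover have "Ln (exp z) = z"
  proof (rule Ln_exp)
    have "(real r + 1) * \<phi> > 0" using \<phi> by simp
    then show "- pi < Im z" using pi_gt_zero by (simp only: z_def complex.sel)
    show "Im z \<le> pi" using sin_pos(4)[OF \<phi>] by (simp add: z_def)
  qed
  ultimately show ?thesis by (simp add: z_def)
qed

lemma tendsto_curve_0: "(curve \<longlongrightarrow> of_real (1 / real r)) (at_right 0)"
proof -
  have "((\<lambda>\<phi>::real. sin \<phi> / sin (real r * \<phi>)) \<longlongrightarrow> inverse (real r)) (at_right 0)"
    using r by real_asymp
  moreover have "((\<lambda>\<phi>. cis ((real r + 1) * \<phi>)) \<longlongrightarrow> cis ((real r + 1) * 0)) (at_right 0)"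
    by (intro tendsto_intros)
  ultimately have "((\<lambda>\<phi>. of_real (sin \<phi> / sin (real r * \<phi>)) * cis ((real r + 1) * \<phi>)) \<longlongrightarrow>
      of_real (inverse (real r)) * cis ((real r + 1) * 0)) (at_right 0)"
    by (intro tendsto_intros)
  then show ?thesis by (simp add: curve_def[abs_def] divide_inverse)
qed

lemma tendsto_curve_max: "(curve \<longlongrightarrow> - 1) (at_left angle_max)"
proof -
  have R: "(real r + 1) * angle_max = pi" by (simp add: angle_max_def add_nonneg_eq_0_iff)
  then have e: "real r * angle_max = pi - angle_max" by (simp add: algebra_simps)
  have "angle_max < pi" using r by (simp add: angle_max_def field_simps)
  then have s: "sin angle_max > 0" using angle_max_pos by (intro sin_gt_zero)
  have "(curve \<longlongrightarrow> of_real (sin angle_max / sin (real r * angle_max)) * cis ((real r + 1) * angle_max)) (at_left angle_max)"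
    unfolding curve_def[abs_def] using s by (intro tendsto_intros) (simp add: e)
  then show ?thesis using s unfolding R e by (simp add: cis_pi)
qed

text \<open>
  \<open>q\<close> has a primitive in the upper half-plane whose imaginary part tends to \<open>0\<close> at the start
  and to \<open>a\<close> at the end of the curve.
\<close>

definition curve_primitive :: "(complex \<Rightarrow> complex) \<Rightarrow> real \<Rightarrow> bool" where
  "curve_primitive q a \<longleftrightarrow> (\<exists>G. (\<forall>u. Im u > 0 \<longrightarrow> (G has_field_derivative q u) (at u)) \<and>
     ((\<lambda>\<phi>. Im (G (curve \<phi>))) \<longlongrightarrow> 0) (at_right 0) \<and>
     ((\<lambda>\<phi>. Im (G (curve \<phi>))) \<longlongrightarrow> a) (at_left angle_max))"

lemma curve_primitive_cong:
  assumes "curve_primitive q a" "\<And>u. Im u > 0 \<Longrightarrow> q u = p u" "a = b"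
  shows "curve_primitive p b"
  using assms unfolding curve_primitive_def by metis

lemma curve_primitive_0: "curve_primitive (\<lambda>u. 0) 0"
  unfolding curve_primitive_def by (rule exI[of _ "\<lambda>_. 0"]) simp

lemma curve_primitive_add:
  assumes "curve_primitive p a" "curve_primitive q b"
  shows "curve_primitive (\<lambda>u. p u + q u) (a + b)"
proof -
  obtain G H where G: "\<And>u. Im u > 0 \<Longrightarrow> (G has_field_derivative p u) (at u)"
    "((\<lambda>\<phi>. Im (G (curve \<phi>))) \<longlongrightarrow> 0) (at_right 0)" "((\<lambda>\<phi>. Im (G (curve \<phi>))) \<longlongrightarrow> a) (at_left angle_max)"
    and H: "\<And>u. Im u > 0 \<Longrightarrow> (H has_field_derivative q u) (at u)"
    "((\<lambda>\<phi>. Im (H (curve \<phi>))) \<longlongrightarrow> 0) (at_right 0)" "((\<lambda>\<phi>. Im (H (curve \<phi>))) \<longlongrightarrow> b) (at_left angle_max)"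
    using assms unfolding curve_primitive_def by blast
  show ?thesis unfolding curve_primitive_def
    by (rule exI[of _ "\<lambda>u. G u + H u"])
      (use DERIV_add[OF G(1) H(1)] tendsto_add[OF G(2) H(2)] tendsto_add[OF G(3) H(3)] in simp)
qed

lemma curve_primitive_scale:
  assumes "curve_primitive p a"
  shows "curve_primitive (\<lambda>u. of_real c * p u) (c * a)"
proof -
  obtain G where G: "\<And>u. Im u > 0 \<Longrightarrow> (G has_field_derivative p u) (at u)"
    "((\<lambda>\<phi>. Im (G (curve \<phi>))) \<longlongrightarrow> 0) (at_right 0)" "((\<lambda>\<phi>. Im (G (curve \<phi>))) \<longlongrightarrow> a) (at_left angle_max)"
    using assms unfolding curve_primitive_def by blast
  show ?thesis unfolding curve_primitive_def
    by (rule exI[of _ "\<lambda>u. of_real c * G u"])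
      (use DERIV_cmult[OF G(1), of _ "of_real c"] tendsto_mult_left[OF G(2), of c]
        tendsto_mult_left[OF G(3), of c] in simp)
qed

lemma curve_primitive_sum:
  assumes "\<And>j. j \<in> A \<Longrightarrow> curve_primitive (p j) (a j)"
  shows "curve_primitive (\<lambda>u. \<Sum>j\<in>A. p j u) (\<Sum>j\<in>A. a j)"
  using assms
  by (induction A rule: infinite_finite_induct)
     (simp_all add: curve_primitive_0 curve_primitive_add)

text \<open>Both end points are real, so among the powers only \<open>1 / u\<close>, with primitive \<open>Ln u\<close>, contributes.\<close>

lemma curve_primitive_power_int:
  "curve_primitive (\<lambda>u. u powi m) (if m = - 1 then pi else 0)"
proof (cases "m = - 1")
  case True
  have "\<forall>\<^sub>F \<phi> in at_right 0. Im (Ln (curve \<phi>)) = (real r + 1) * \<phi>"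
    using eventually_at_right_less[of 0] eventually_at_right_field[of _ 0]
    by (subst eventually_at_right_field) (use angle_max_pos curve_Ln in blast)
  moreover have "\<forall>\<^sub>F \<phi> in at_left angle_max. Im (Ln (curve \<phi>)) = (real r + 1) * \<phi>"
    by (subst eventually_at_left_field) (use angle_max_pos curve_Ln in blast)
  moreover have "((\<lambda>\<phi>. (real r + 1) * \<phi>) \<longlongrightarrow> (real r + 1) * 0) (at_right 0)"
    "((\<lambda>\<phi>. (real r + 1) * \<phi>) \<longlongrightarrow> (real r + 1) * angle_max) (at_left angle_max)"
    by (intro tendsto_intros)+
  moreover have "(real r + 1) * angle_max = pi" by (simp add: angle_max_def add_nonneg_eq_0_iff)
  ultimately have "((\<lambda>\<phi>. Im (Ln (curve \<phi>))) \<longlongrightarrow> 0) (at_right 0)"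
    "((\<lambda>\<phi>. Im (Ln (curve \<phi>))) \<longlongrightarrow> pi) (at_left angle_max)"
    by (simp_all add: tendsto_cong)
  moreover have "(Ln has_field_derivative u powi m) (at u)" if "Im u > 0" for u
    using that True by (auto intro!: derivative_eq_intros simp: complex_nonpos_Reals_iff power_int_minus)
  ultimately show ?thesis using True unfolding curve_primitive_def by auto
next
  case False
  define G where "G = (\<lambda>u :: complex. u powi (m + 1) / of_int (m + 1))"
  have m: "(of_int (m + 1) :: complex) \<noteq> 0"
    using False by (metis add.commute add_eq_0_iff of_int_eq_0_iff)
  have "(G has_field_derivative u powi m) (at u)" if "Im u > 0" for u
  proof -
    have "u \<noteq> 0" using that by auto
    then have "((\<lambda>u. u powi (m + 1)) has_field_derivative of_int (m + 1) * u powi m * 1) (at u)"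
      using DERIV_power_int[OF DERIV_ident, where n = "m + 1" and x = u and s = UNIV] by simp
    from DERIV_cdivide[OF this, of "of_int (m + 1)"] show ?thesis
      using m by (simp add: G_def)
  qed
  moreover have lim: "((\<lambda>\<phi>. Im (G (curve \<phi>))) \<longlongrightarrow> 0) F"
    if "(curve \<longlongrightarrow> of_real x) F" "x \<noteq> 0" for F x
  proof -
    have "((\<lambda>\<phi>. Im (G (curve \<phi>))) \<longlongrightarrow> Im (G (of_real x))) F"
      unfolding G_def by (intro tendsto_intros that) (use m that(2) in auto)
    moreover have "G (of_real x) = of_real (x powi (m + 1) / of_int (m + 1))" by (simp add: G_def)
    ultimately show ?thesis by (simp only: Im_complex_of_real)
  qed
  ultimately show ?thesis
    using lim[OF tendsto_curve_0] lim[of "- 1" "at_left angle_max"] tendsto_curve_max r False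
    unfolding curve_primitive_def by (auto intro!: exI[of _ G])
qed

text \<open>
  The factor \<open>r - 1\<close> disposes of the case \<open>r = 1\<close>, in which the curve starts at the pole \<open>1\<close>.
\<close>

lemma curve_primitive_geometric:
  "curve_primitive (\<lambda>u. of_real (real r - 1) * (u powi m / (1 - u))) (if m < 0 then (real r - 1) * pi else 0)"
proof -
  have zero: "curve_primitive (\<lambda>u. of_real (real r - 1) * (u powi 0 / (1 - u))) (if (0 :: int) < 0 then (real r - 1) * pi else 0)"
  proof (cases "r = 1")
    case True
    then show ?thesis using curve_primitive_0 by simp
  next
    case False
    define G where "G = (\<lambda>u. of_real (real r - 1) * - Ln (1 - u))"
    have "(G has_field_derivative of_real (real r - 1) * (u powi 0 / (1 - u))) (at u)" if "Im u > 0" for u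
    proof -
      have "1 - u \<notin> \<real>\<^sub>\<le>\<^sub>0" using that by (auto simp: complex_nonpos_Reals_iff)
      then show ?thesis unfolding G_def
        by (auto intro!: derivative_eq_intros simp: divide_inverse)
    qed
    moreover have lim: "((\<lambda>\<phi>. Im (G (curve \<phi>))) \<longlongrightarrow> 0) F"
      if "(curve \<longlongrightarrow> of_real x) F" "x < 1" for F x
    proof -
      have "1 - complex_of_real x \<notin> \<real>\<^sub>\<le>\<^sub>0" using that by (auto simp: complex_nonpos_Reals_iff)
      then have "((\<lambda>\<phi>. Im (G (curve \<phi>))) \<longlongrightarrow> Im (G (of_real x))) F"
        unfolding G_def by (intro tendsto_intros that)
      moreover have "Im (G (of_real x)) = 0"
        using that(2) Ln_of_real[of "1 - x"] by (simp add: G_def)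
      ultimately show ?thesis by simp
    qed
    moreover have "1 / real r < 1" using False r by simp
    ultimately show ?thesis
      using lim[OF tendsto_curve_0] lim[of "- 1" "at_left angle_max"] tendsto_curve_max
      unfolding curve_primitive_def by (auto intro!: exI[of _ G])
  qed
  have step: "u powi k / (1 - u) = u powi (k + 1) / (1 - u) + u powi k" if "Im u > 0" for u k
  proof -
    have "u \<noteq> 0" "1 - u \<noteq> 0" using that by auto
    then show ?thesis by (simp add: power_int_add field_simps)
  qed
  show ?thesis
  proof (induction m rule: int_induct[where k = 0])
    case base
    show ?case by (rule zero)
  next
    case (step1 i)
    show ?case
      by (rule curve_primitive_cong[OF curve_primitive_add[OF step1(2)
            curve_primitive_scale[OF curve_primitive_power_int[of i], of "- (real r - 1)"]]])
        (use step1(1) step[of _ i] in \<open>auto simp: algebra_simps\<close>)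
  next
    case (step2 i)
    show ?case
      by (rule curve_primitive_cong[OF curve_primitive_add[OF step2(2)
            curve_primitive_scale[OF curve_primitive_power_int[of "i - 1"], of "real r - 1"]]])
        (use step2(1) step[of _ "i - 1"] in \<open>auto simp: algebra_simps\<close>)
  qed
qed

text \<open>
  The coefficient of \<open>u\<^sup>n\<close> in \<open>(1 + u)\<^sup>N (1 - r u) / (1 - u)\<close>, divided by \<open>2\<^sup>N\<close>, for \<open>N = (r + 1) n\<close>.
\<close>

definition raney_moment :: "nat \<Rightarrow> real" where
  "raney_moment n = (\<Sum>j\<le>(r + 1) * n. real (((r + 1) * n) choose j) / 2 ^ ((r + 1) * n) *
     ((if j = n then 1 else 0) - (if j < n then real r - 1 else 0)))"

text \<open>Expand \<open>x\<^sup>n\<close> into powers of \<open>u\<close> by the binomial theorem.\<close>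

lemma curve_primitive_moment:
  "curve_primitive (\<lambda>u. spectral_map u ^ n * (of_real (real r - 1) / (1 - u) - 1 / u)) (- pi * raney_moment n)"
proof -
  define N where "N = (r + 1) * n"
  define c where "c j = real (N choose j) / 2 ^ N" for j
  have "curve_primitive (\<lambda>u. \<Sum>j\<le>N. of_real (c j) * (of_real (real r - 1) * (u powi (int j - int n) / (1 - u))
        + of_real (- 1) * u powi (int j - int n - 1)))
      (\<Sum>j\<le>N. c j * ((if int j - int n < 0 then (real r - 1) * pi else 0)
        + (- 1) * (if int j - int n - 1 = - 1 then pi else 0)))"
    by (intro curve_primitive_sum curve_primitive_scale curve_primitive_add
        curve_primitive_geometric curve_primitive_power_int)
  then show ?thesis
  proof (rule curve_primitive_cong)
    show "(\<Sum>j\<le>N. c j * ((if int j - int n < 0 then (real r - 1) * pi else 0)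
        + (- 1) * (if int j - int n - 1 = - 1 then pi else 0))) = - pi * raney_moment n"
      unfolding raney_moment_def sum_distrib_left N_def[symmetric] c_def
      by (intro sum.cong refl) (auto simp: algebra_simps)
  next
    fix u :: complex assume "Im u > 0"
    then have u: "u \<noteq> 0" "1 - u \<noteq> 0" by auto
    have "spectral_map u ^ n = (u + 1) ^ N / (2 ^ N * u ^ n)"
      by (simp add: spectral_map_def N_def power_divide power_mult_distrib add.commute power_add flip: power_mult)
    also have "(u + 1) ^ N = (\<Sum>j\<le>N. of_nat (N choose j) * u ^ j)"
      using binomial_ring[of u 1 N] by simp
    also have "\<dots> / (2 ^ N * u ^ n) = (\<Sum>j\<le>N. of_real (c j) * u powi (int j - int n))"
      using u by (simp add: c_def sum_divide_distrib power_int_diff)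
    finally have S: "spectral_map u ^ n = (\<Sum>j\<le>N. of_real (c j) * u powi (int j - int n))" .
    have pred: "u powi (k - 1) = u powi k / u" for k using u by (simp add: power_int_diff)
    show "(\<Sum>j\<le>N. of_real (c j) * (of_real (real r - 1) * (u powi (int j - int n) / (1 - u))
        + of_real (- 1) * u powi (int j - int n - 1))) =
        spectral_map u ^ n * (of_real (real r - 1) / (1 - u) - 1 / u)"
      unfolding S sum_distrib_right pred by (intro sum.cong refl) (simp add: algebra_simps)
  qed
qed

end

section \<open>The density and its moments\<close>

context raney
begin

lemma tendsto_spectral_var:
  "(spectral_var \<longlongrightarrow> spectral_max) (at_right 0)" "(spectral_var \<longlongrightarrow> 0) (at_left angle_max)"
proof -
  have lim: "(spectral_var \<longlongrightarrow> Re (spectral_map c)) F"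
    if "(curve \<longlongrightarrow> c) F" "c \<noteq> 0" "\<forall>\<^sub>F \<phi> in F. 0 < \<phi> \<and> \<phi> < angle_max" for c F
  proof -
    have "((\<lambda>\<phi>. Re (spectral_map (curve \<phi>))) \<longlongrightarrow> Re (spectral_map c)) F"
      unfolding spectral_map_def by (intro tendsto_intros that) (use that in auto)
    moreover have "\<forall>\<^sub>F \<phi> in F. Re (spectral_map (curve \<phi>)) = spectral_var \<phi>"
      using that(3) by eventually_elim (simp add: spectral_map_curve)
    ultimately show ?thesis by (simp add: tendsto_cong)
  qed
  have "\<forall>\<^sub>F \<phi> in at_right 0. 0 < \<phi> \<and> \<phi> < angle_max"
    by (subst eventually_at_right_field) (use angle_max_pos in blast)
  then have "(spectral_var \<longlongrightarrow> Re (spectral_map (of_real (1 / real r)))) (at_right 0)"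
    using tendsto_curve_0 r by (intro lim) auto
  moreover have "Re (spectral_map (of_real (1 / real r))) = spectral_max"
  proof -
    have "spectral_map (of_real (1 / real r)) = of_real ((1 + 1 / real r) ^ (r + 1) / (2 ^ (r + 1) * (1 / real r)))"
      by (simp add: spectral_map_def)
    also have "(1 + 1 / real r) ^ (r + 1) / (2 ^ (r + 1) * (1 / real r)) = spectral_max"
    proof -
      have "1 + 1 / real r = (real r + 1) / real r" using r by (simp add: field_simps)
      then show ?thesis using r by (simp add: spectral_max_def power_divide)
    qed
    finally show ?thesis by simp
  qed
  ultimately show "(spectral_var \<longlongrightarrow> spectral_max) (at_right 0)" by simp
  have "\<forall>\<^sub>F \<phi> in at_left angle_max. 0 < \<phi> \<and> \<phi> < angle_max"
    by (subst eventually_at_left_field) (use angle_max_pos in blast)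
  then have "(spectral_var \<longlongrightarrow> Re (spectral_map (- 1))) (at_left angle_max)"
    using tendsto_curve_max by (intro lim) auto
  then show "(spectral_var \<longlongrightarrow> 0) (at_left angle_max)" by (simp add: spectral_map_def)
qed

lemma spectral_max_pos: "spectral_max > 0"
  using r by (simp add: spectral_max_def)

lemma spectral_var_decreasing:
  assumes "0 < a" "a < c" "c < angle_max"
  shows "spectral_var c < spectral_var a"
  by (rule DERIV_neg_imp_decreasing[OF assms(2)])
     (use assms spectral_var_deriv(1,3) in \<open>meson less_le_trans le_less_trans\<close>)

lemma isCont_spectral_var:
  assumes "0 < \<phi>" "\<phi> < angle_max"
  shows "isCont spectral_var \<phi>"
  using DERIV_isCont[OF spectral_var_deriv(1)[OF assms]] .

lemma spectral_var_bij: "bij_betw spectral_var {0<..<angle_max} {0<..<spectral_max}"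
  unfolding bij_betw_def
proof
  show "inj_on spectral_var {0<..<angle_max}"
  proof (rule inj_onI)
    fix a c assume *: "a \<in> {0<..<angle_max}" "c \<in> {0<..<angle_max}" "spectral_var a = spectral_var c"
    show "a = c"
    proof (rule ccontr)
      assume "a \<noteq> c"
      then consider "a < c" | "c < a" by linarith
      then show False
      proof cases
        case 1
        then show False using spectral_var_decreasing[of a c] * by simp
      next
        case 2
        then show False using spectral_var_decreasing[of c a] * by simp
      qed
    qed
  qed
  show "spectral_var ` {0<..<angle_max} = {0<..<spectral_max}"
  proof (intro equalityI subsetI)
    fix y assume "y \<in> spectral_var ` {0<..<angle_max}"
    then obtain \<phi> where \<phi>: "0 < \<phi>" "\<phi> < angle_max" "y = spectral_var \<phi>" by auto
    have "spectral_var (\<phi> / 2) \<le> spectral_max"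
    proof (rule tendsto_lowerbound[OF tendsto_spectral_var(1)])
      show "\<forall>\<^sub>F \<theta> in at_right 0. spectral_var (\<phi> / 2) \<le> spectral_var \<theta>"
        by (subst eventually_at_right_field)
          (use \<phi> spectral_var_decreasing[of _ "\<phi> / 2"] in \<open>auto intro!: exI[of _ "\<phi> / 2"] less_imp_le\<close>)
    qed simp
    moreover have "spectral_var \<phi> < spectral_var (\<phi> / 2)"
      using \<phi> by (intro spectral_var_decreasing) auto
    ultimately show "y \<in> {0<..<spectral_max}" using \<phi> spectral_var_pos by simp
  next
    fix y assume y: "y \<in> {0<..<spectral_max}"
    have "\<forall>\<^sub>F \<phi> in at_right 0. spectral_var \<phi> > y"
      using order_tendstoD(1)[OF tendsto_spectral_var(1)] y by simp
    then obtain e where e: "e > 0" "\<And>\<phi>. 0 < \<phi> \<Longrightarrow> \<phi> < e \<Longrightarrow> spectral_var \<phi> > y"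
      unfolding eventually_at_right_field by blast
    have "\<forall>\<^sub>F \<phi> in at_left angle_max. spectral_var \<phi> < y"
      using order_tendstoD(2)[OF tendsto_spectral_var(2)] y by simp
    then obtain e' where e': "e' < angle_max" "\<And>\<phi>. e' < \<phi> \<Longrightarrow> \<phi> < angle_max \<Longrightarrow> spectral_var \<phi> < y"
      unfolding eventually_at_left_field by blast
    define a where "a = min (e / 2) (angle_max / 2)"
    define c where "c = max ((e' + angle_max) / 2) (angle_max / 2)"
    have ac: "0 < a" "a < e" "a \<le> c" "c < angle_max" "e' < c"
      using e(1) e'(1) angle_max_pos by (auto simp: a_def c_def min_def max_def)
    have "\<exists>\<phi>\<ge>a. \<phi> \<le> c \<and> spectral_var \<phi> = y"
      using ac e(2)[of a] e'(2)[of c] isCont_spectral_var by (intro IVT2) auto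
    then show "y \<in> spectral_var ` {0<..<angle_max}" using ac by force
  qed
qed

text \<open>The inverse of the parametrization.\<close>

definition angle :: "real \<Rightarrow> real" where
  "angle = the_inv_into {0<..<angle_max} spectral_var"

lemma angle:
  assumes "0 < y" "y < spectral_max"
  shows "0 < angle y" "angle y < angle_max" "spectral_var (angle y) = y"
proof -
  have inj: "inj_on spectral_var {0<..<angle_max}" and im: "spectral_var ` {0<..<angle_max} = {0<..<spectral_max}"
    using spectral_var_bij by (auto simp: bij_betw_def)
  have y: "y \<in> spectral_var ` {0<..<angle_max}" using assms im by simp
  show "spectral_var (angle y) = y" unfolding angle_def by (rule f_the_inv_into_f[OF inj y])
  have "angle y \<in> {0<..<angle_max}" unfolding angle_def by (rule the_inv_into_into[OF inj y]) simp
  then show "0 < angle y" "angle y < angle_max" by simp_all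
qed

lemma angle_spectral_var:
  assumes "0 < \<phi>" "\<phi> < angle_max"
  shows "angle (spectral_var \<phi>) = \<phi>"
  unfolding angle_def using spectral_var_bij assms by (intro the_inv_into_f_f) (auto simp: bij_betw_def)

lemma spectral_var_range:
  assumes "0 < \<phi>" "\<phi> < angle_max"
  shows "0 < spectral_var \<phi>" "spectral_var \<phi> < spectral_max"
  using bij_betwE[OF spectral_var_bij] assms by auto

lemma angle_less_iff:
  assumes "0 < y" "y < spectral_max" "0 < \<phi>" "\<phi> < angle_max"
  shows "angle y < \<phi> \<longleftrightarrow> spectral_var \<phi> < y"
  using spectral_var_decreasing[of "angle y" \<phi>] spectral_var_decreasing[of \<phi> "angle y"] angle[of y] assms
  by (metis less_asym linorder_neqE_linordered_idom)

lemma isCont_angle: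
  assumes "0 < y" "y < spectral_max"
  shows "isCont angle y"
proof -
  note a = angle[OF assms]
  define d where "d = min (angle y) (angle_max - angle y) / 2"
  have d: "d > 0" "d < angle y" "d < angle_max - angle y" using a by (auto simp: d_def min_def)
  have "isCont angle (spectral_var (angle y))"
  proof (rule isCont_inverse_function[where f = spectral_var and x = "angle y" and d = d])
    show "0 < d" by (fact d(1))
    have z: "0 < z" "z < angle_max" if "\<bar>z - angle y\<bar> \<le> d" for z
      using that d by (auto simp: abs_le_iff)
    show "angle (spectral_var z) = z" if "\<bar>z - angle y\<bar> \<le> d" for z
      using z[OF that] by (rule angle_spectral_var)
    show "isCont spectral_var z" if "\<bar>z - angle y\<bar> \<le> d" for z
      using z[OF that] by (rule isCont_spectral_var)
  qed
  then show ?thesis by (simp add: a)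
qed

lemma angle_deriv:
  assumes "0 < y" "y < spectral_max"
  shows "(angle has_real_derivative inverse (spectral_slope (angle y))) (at y)"
  using angle[OF assms] spectral_var_deriv[of "angle y"] isCont_angle[OF assms] assms
  by (intro DERIV_inverse_function[where f = spectral_var and a = 0 and b = spectral_max])
    (auto simp: angle)

lemma filterlim_angle:
  "filterlim angle (at_left angle_max) (at_right 0)"
  "filterlim angle (at_right 0) (at_left spectral_max)"
proof -
  have ev0: "\<forall>\<^sub>F y in at_right 0. y \<in> {0<..<x}" if "x > 0" for x :: real
    using eventually_at_right_real[OF that] .
  show "filterlim angle (at_left angle_max) (at_right 0)"
  proof (rule tendsto_imp_filterlim_at_left)
    show ev: "\<forall>\<^sub>F y in at_right 0. angle y < angle_max"
      using ev0[OF spectral_max_pos] by eventually_elim (simp add: angle)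
    show "(angle \<longlongrightarrow> angle_max) (at_right 0)"
    proof (rule order_tendstoI)
      fix a assume "a < angle_max"
      define a' where "a' = max a (angle_max / 2)"
      have a': "0 < a'" "a' < angle_max" "a \<le> a'"
        using \<open>a < angle_max\<close> angle_max_pos by (auto simp: a'_def)
      show "\<forall>\<^sub>F y in at_right 0. a < angle y"
        using ev0[OF spectral_var_range(1)[OF a'(1,2)]]
      proof eventually_elim
        case (elim y)
        have "y < spectral_max" using elim spectral_var_range(2)[OF a'(1,2)] by simp
        moreover have "angle y \<noteq> a'" using elim angle(3)[of y] calculation by auto
        ultimately have "angle y > a'"
          using angle_less_iff[of y a'] elim a' by (simp add: not_less le_less)
        then show ?case using a'(3) by simp
      qed
    next
      fix a assume "angle_max < a"
      then show "\<forall>\<^sub>F y in at_right 0. angle y < a" using ev by (auto elim: eventually_mono)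
    qed
  qed
  have ev1: "\<forall>\<^sub>F y in at_left spectral_max. y \<in> {x<..<spectral_max}" if "x < spectral_max" for x
    using eventually_at_left_real[OF that] .
  show "filterlim angle (at_right 0) (at_left spectral_max)"
  proof (rule tendsto_imp_filterlim_at_right)
    show ev: "\<forall>\<^sub>F y in at_left spectral_max. angle y > 0"
      using ev1[OF spectral_max_pos] by eventually_elim (simp add: angle)
    show "(angle \<longlongrightarrow> 0) (at_left spectral_max)"
    proof (rule order_tendstoI)
      fix a :: real assume "0 < a"
      define a' where "a' = min a (angle_max / 2)"
      have a': "0 < a'" "a' < angle_max" "a' \<le> a"
        using \<open>0 < a\<close> angle_max_pos by (auto simp: a'_def)
      show "\<forall>\<^sub>F y in at_left spectral_max. angle y < a"
        using ev1[OF spectral_var_range(2)[OF a'(1,2)]]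
      proof eventually_elim
        case (elim y)
        then have "angle y < a'"
          using angle_less_iff[of y a'] a' spectral_var_range[OF a'(1,2)] by auto
        then show ?case using a'(3) by simp
      qed
    next
      fix a :: real assume "a < 0"
      then show "\<forall>\<^sub>F y in at_left spectral_max. a < angle y" using ev by (auto elim: eventually_mono)
    qed
  qed
qed

text \<open>The density as a function of the spectral variable.\<close>

definition raney_density :: "real \<Rightarrow> real" where
  "raney_density y = (if y \<in> {0<..<spectral_max} then spectral_density (angle y) else 0)"

lemma raney_density_nonneg: "raney_density y \<ge> 0"
  using spectral_density_pos[of "angle y"] angle[of y] by (auto simp: raney_density_def intro: less_imp_le)

lemma isCont_spectral_density_angle:
  assumes "0 < y" "y < spectral_max"
  shows "isCont (\<lambda>y. spectral_density (angle y)) y"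
proof -
  note a = angle[OF assms]
  note s = sin_pos[OF a(1,2)]
  have "4 * (sin (angle y))\<^sup>2 * (sin (real r * angle y))\<^sup>2 + (sin ((real r - 1) * angle y))\<^sup>2 > 0"
    using s by (intro add_pos_nonneg) auto
  then have "isCont spectral_density (angle y)"
    unfolding spectral_density_def using s by (intro continuous_intros) auto
  then show ?thesis using isCont_o2[OF isCont_angle[OF assms], of spectral_density] by blast
qed

lemma raney_density_measurable [measurable]: "raney_density \<in> borel_measurable borel"
proof -
  have "(\<lambda>y. indicator {0<..<spectral_max} y *\<^sub>R spectral_density (angle y)) \<in> borel_measurable borel"
    by (rule borel_measurable_continuous_on_indicator)
      (auto intro!: continuous_at_imp_continuous_on isCont_spectral_density_angle)
  moreover have "(\<lambda>y. indicator {0<..<spectral_max} y *\<^sub>R spectral_density (angle y)) = raney_density"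
    by (auto simp: raney_density_def fun_eq_iff)
  ultimately show ?thesis by simp
qed

text \<open>
  The function \<open>y \<mapsto> Im G(u(\<phi>)) / \<pi>\<close> with \<open>x(\<phi>) = y\<close> is a primitive of the \<open>n\<close>-th moment integrand, if
  \<open>G\<close> is the complex primitive; \<open>y\<close> tends to \<open>0\<close> at the end of the curve and to the maximum at its start.
\<close>

lemma raney_density_moment:
  "integrable lborel (\<lambda>y. raney_density y * y ^ n)"
  "(\<integral>y. raney_density y * y ^ n \<partial>lborel) = raney_moment n"
proof -
  obtain G where G: "\<And>u. Im u > 0 \<Longrightarrow>
      (G has_field_derivative spectral_map u ^ n * (of_real (real r - 1) / (1 - u) - 1 / u)) (at u)"
    and G0: "((\<lambda>\<phi>. Im (G (curve \<phi>))) \<longlongrightarrow> 0) (at_right 0)"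
    and Gmax: "((\<lambda>\<phi>. Im (G (curve \<phi>))) \<longlongrightarrow> - pi * raney_moment n) (at_left angle_max)"
    using curve_primitive_moment unfolding curve_primitive_def by blast
  define F where "F y = Im (G (curve (angle y))) / pi" for y
  define f where "f y = y ^ n * spectral_density (angle y)" for y
  have FD: "DERIV F y :> f y" if y: "0 < y" "y < spectral_max" for y
  proof -
    note a = angle[OF y]
    have "((G \<circ> curve) has_vector_derivative curve (angle y) * curve_slope (angle y) *
        (spectral_map (curve (angle y)) ^ n * (of_real (real r - 1) / (1 - curve (angle y)) - 1 / curve (angle y))))
        (at (angle y))"
      by (intro field_vector_diff_chain_at curve_deriv a G Im_curve_pos)
    from has_field_derivative_Im[OF this]
    have "((\<lambda>\<phi>. Im (G (curve \<phi>))) has_real_derivative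
        pi * y ^ n * spectral_density (angle y) * spectral_slope (angle y)) (at (angle y))"
      using moment_integrand_Im[OF a(1,2), of n] by (simp only: mult.commute[of "curve (angle y) * _"] o_def a)
    from DERIV_chain2[OF this angle_deriv[OF y]]
    have "((\<lambda>y. Im (G (curve (angle y)))) has_real_derivative pi * f y) (at y)"
      using spectral_var_deriv(3)[OF a(1,2)] by (simp add: f_def mult.assoc)
    from DERIV_cdivide[OF this, of pi] show ?thesis by (simp add: F_def[abs_def])
  qed
  have lims: "((F \<circ> real_of_ereal) \<longlongrightarrow> - raney_moment n) (at_right 0)"
    "((F \<circ> real_of_ereal) \<longlongrightarrow> 0) (at_left (ereal spectral_max))"
  proof -
    have "((\<lambda>y. Im (G (curve (angle y))) / pi) \<longlongrightarrow> (- pi * raney_moment n) / pi) (at_right 0)"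
      by (intro tendsto_intros filterlim_compose[OF Gmax filterlim_angle(1)]) simp
    then show "((F \<circ> real_of_ereal) \<longlongrightarrow> - raney_moment n) (at_right 0)"
      using ereal_tendsto_simps1(2)[of F _ 0] by (simp add: F_def[abs_def] zero_ereal_def)
    have "((\<lambda>y. Im (G (curve (angle y))) / pi) \<longlongrightarrow> 0 / pi) (at_left spectral_max)"
      by (intro tendsto_intros filterlim_compose[OF G0 filterlim_angle(2)]) simp
    then show "((F \<circ> real_of_ereal) \<longlongrightarrow> 0) (at_left (ereal spectral_max))"
      using ereal_tendsto_simps1(1)[of F _ spectral_max] by (simp add: F_def[abs_def])
  qed
  have ftc: "set_integrable lborel (einterval 0 spectral_max) f"
    "(LBINT y=0..spectral_max. f y) = 0 - (- raney_moment n)"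
  proof -
    note * = interval_integral_FTC_nonneg[of 0 "ereal spectral_max" F f "- raney_moment n" 0]
    have 1: "(0 :: ereal) < ereal spectral_max" using spectral_max_pos by simp
    have 2: "isCont f y" if "0 < ereal y" "ereal y < ereal spectral_max" for y
      using isCont_spectral_density_angle[of y] that unfolding f_def by (intro continuous_intros) auto
    have 3: "AE y in lborel. 0 < ereal y \<longrightarrow> ereal y < ereal spectral_max \<longrightarrow> 0 \<le> f y"
      using spectral_density_pos angle by (intro AE_I2) (auto simp: f_def less_imp_le)
    show "set_integrable lborel (einterval 0 spectral_max) f"
      "(LBINT y=0..spectral_max. f y) = 0 - (- raney_moment n)"
      by (rule *[OF 1 _ 2 3 lims]; use FD in simp)+
  qed
  have eq: "(\<lambda>y. indicator (einterval 0 spectral_max) y *\<^sub>R f y) = (\<lambda>y. raney_density y * y ^ n)"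
    by (auto simp: fun_eq_iff f_def raney_density_def einterval_def)
  show "integrable lborel (\<lambda>y. raney_density y * y ^ n)"
    using ftc(1) unfolding set_integrable_def eq .
  show "(\<integral>y. raney_density y * y ^ n \<partial>lborel) = raney_moment n"
    using ftc(2) spectral_max_pos
    unfolding interval_lebesgue_integral_def set_lebesgue_integral_def eq by simp
qed

end

section \<open>Measures with bounded support\<close>

lemma compact_moment_bound:
  assumes "compact_nonneg_distribution \<mu>"
  obtains B where "B \<ge> 0" "\<And>n. integrable \<mu> (\<lambda>x. x ^ n)" "\<And>n. (\<integral>x. \<bar>x\<bar> ^ n \<partial>\<mu>) \<le> B ^ n"
proof -
  interpret prob_space \<mu> using assms by (simp add: compact_nonneg_distribution_def)
  have [measurable_cong]: "sets \<mu> = sets borel" using assms by (simp add: compact_nonneg_distribution_def)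
  obtain B where B: "AE x in \<mu>. 0 \<le> x \<and> x \<le> B"
    using assms by (auto simp: compact_nonneg_distribution_def)
  have B0: "B \<ge> 0"
  proof (rule ccontr)
    assume "\<not> B \<ge> 0"
    then have "AE x in \<mu>. False" using \<open>\<not> B \<ge> 0\<close> by (intro eventually_mono[OF B]) auto
    then show False by simp
  qed
  have bound: "AE x in \<mu>. norm (\<bar>x\<bar> ^ n) \<le> B ^ n" for n
    using B by eventually_elim (auto intro: power_mono)
  have int: "integrable \<mu> (\<lambda>x. \<bar>x\<bar> ^ n)" for n
    by (rule integrable_const_bound[OF bound]) measurable
  have "integrable \<mu> (\<lambda>x. x ^ n)" for n
    by (rule integrable_const_bound[where B = "B ^ n"]) (use bound in \<open>auto simp: power_abs\<close>)
  moreover have "(\<integral>x. \<bar>x\<bar> ^ n \<partial>\<mu>) \<le> B ^ n" for n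
  proof -
    have "(\<integral>x. \<bar>x\<bar> ^ n \<partial>\<mu>) \<le> (\<integral>x. B ^ n \<partial>\<mu>)"
      using bound[of n] by (intro integral_mono_AE int) auto
    then show ?thesis by (simp add: prob_space)
  qed
  ultimately show thesis using that B0 by blast
qed

text \<open>The moments determine the characteristic function, hence the measure.\<close>

lemma char_moment_series:
  assumes "compact_nonneg_distribution \<mu>"
  shows "(\<lambda>n. \<Sum>k\<le>n. ((\<i> * of_real t) ^ k / fact k) * of_real (moment \<mu> k)) \<longlonglongrightarrow> char \<mu> t"
proof -
  interpret prob_space \<mu> using assms by (simp add: compact_nonneg_distribution_def)
  interpret real_distribution \<mu>
    by standard (use assms in \<open>simp add: compact_nonneg_distribution_def\<close>)
  obtain B where B: "B \<ge> 0" "\<And>n. integrable \<mu> (\<lambda>x. x ^ n)" "\<And>n. (\<integral>x. \<bar>x\<bar> ^ n \<partial>\<mu>) \<le> B ^ n"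
    using compact_moment_bound[OF assms] by blast
  have bound: "norm ((\<Sum>k\<le>n. ((\<i> * of_real t) ^ k / fact k) * of_real (moment \<mu> k)) - char \<mu> t)
      \<le> 2 * ((\<bar>t\<bar> * B) ^ n / fact n)" for n
  proof -
    have "norm ((\<Sum>k\<le>n. ((\<i> * of_real t) ^ k / fact k) * of_real (moment \<mu> k)) - char \<mu> t)
        \<le> (2 * \<bar>t\<bar> ^ n / fact n) * (\<integral>x. \<bar>x\<bar> ^ n \<partial>\<mu>)"
      using char_approx1[of n t] B(2) by (simp add: moment_def norm_minus_commute)
    also have "\<dots> \<le> (2 * \<bar>t\<bar> ^ n / fact n) * B ^ n"
      by (intro mult_left_mono B(3)) simp
    finally show ?thesis by (simp add: power_mult_distrib)
  qed
  have "(\<lambda>n. (\<bar>t\<bar> * B) ^ n / fact n) \<longlonglongrightarrow> 0" 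
    using summable_LIMSEQ_zero[OF summable_exp[of "\<bar>t\<bar> * B"]] by (simp add: field_simps)
  then have "(\<lambda>n. 2 * ((\<bar>t\<bar> * B) ^ n / fact n)) \<longlonglongrightarrow> 0" by (rule tendsto_mult_right_zero)
  then have "(\<lambda>n. (\<Sum>k\<le>n. ((\<i> * of_real t) ^ k / fact k) * of_real (moment \<mu> k)) - char \<mu> t) \<longlonglongrightarrow> 0"
    by (rule Lim_null_comparison[rotated]) (use bound in auto)
  then show ?thesis by (simp add: LIM_zero_iff)
qed

lemma compact_distribution_eqI:
  assumes "compact_nonneg_distribution \<mu>" "compact_nonneg_distribution \<nu>" "\<And>n. moment \<mu> n = moment \<nu> n"
  shows "\<mu> = \<nu>"
proof (rule Levy_uniqueness)
  show "real_distribution \<mu>" "real_distribution \<nu>"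
    using assms(1,2) by (simp_all add: compact_nonneg_distribution_def real_distribution_def real_distribution_axioms_def)
  show "char \<mu> = char \<nu>"
  proof
    fix t
    show "char \<mu> t = char \<nu> t"
      using char_moment_series[OF assms(1), of t] char_moment_series[OF assms(2), of t]
      unfolding assms(3) by (rule LIMSEQ_unique)
  qed
qed

section \<open>Free multiplicative convolution through moment series\<close>

text \<open>The moment generating series \<open>\<Sum>\<^sub>n m\<^sub>n t\<^sup>n\<close>, including \<open>m\<^sub>0\<close>.\<close>

definition moment_series :: "real measure \<Rightarrow> complex fps" where
  "moment_series \<mu> = Abs_fps (\<lambda>n. of_real (moment \<mu> n))"

text \<open>
  The moments of \<open>X Y\<close> are the same for every admissible functional; this and the existence of such
  a functional make the definite description in \<open>free_mult_conv\<close> meaningful.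
\<close>

lemma free_mult_conv_eqI:
  assumes \<mu>: "compact_nonneg_distribution \<mu>" and \<nu>: "compact_nonneg_distribution \<nu>"
    and \<rho>: "compact_nonneg_distribution \<rho>"
    and \<alpha>: "moment_series \<mu> oo \<alpha> = 1 + fps_X" "\<alpha> $ 0 = 0"
    and \<beta>: "moment_series \<nu> oo \<beta> = 1 + fps_X" "\<beta> $ 0 = 0"
    and z: "moment_series \<rho> oo z = 1 + fps_X" "z $ 0 = 0" "z $ 1 \<noteq> 0" "fps_X * z = \<alpha> * \<beta> * (1 + fps_X)"
  shows "free_mult_conv \<mu> \<nu> = \<rho>"
proof -
  define P where "P \<tau> \<rho>' \<longleftrightarrow> unital_functional \<tau> \<and> free_variables \<tau> \<and>
      (\<forall>n. \<tau> (nc_var False ^ n) = complex_of_real (moment \<mu> n)) \<and>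
      (\<forall>n. \<tau> (nc_var True ^ n) = complex_of_real (moment \<nu> n)) \<and>
      (\<forall>n. \<tau> ((nc_var False * nc_var True) ^ n) = complex_of_real (moment \<rho>' n))"
    for \<tau> :: "bool ncpoly \<Rightarrow> complex" and \<rho>'
  have moments: "\<tau> ((nc_var False * nc_var True) ^ n) = complex_of_real (moment \<rho> n)"
    if "unital_functional \<tau>" "free_variables \<tau>"
      "\<And>n. \<tau> (nc_var False ^ n) = complex_of_real (moment \<mu> n)"
      "\<And>n. \<tau> (nc_var True ^ n) = complex_of_real (moment \<nu> n)"
    for \<tau> :: "bool ncpoly \<Rightarrow> complex" and n
  proof -
    have "Abs_fps (\<lambda>n. \<tau> (nc_var False ^ n)) = moment_series \<mu>"
      "Abs_fps (\<lambda>n. \<tau> (nc_var True ^ n)) = moment_series \<nu>"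
      by (simp_all only: that(3,4) moment_series_def)
    then have "Abs_fps (\<lambda>n. \<tau> ((nc_var False * nc_var True) ^ n)) oo z = 1 + fps_X"
      using \<alpha>(1) \<beta>(1) by (intro free_product_moment_series[OF that(1,2) _ \<alpha>(2) \<beta>(2) _ _ z(4)]) simp_all
    then have "Abs_fps (\<lambda>n. \<tau> ((nc_var False * nc_var True) ^ n)) oo z = moment_series \<rho> oo z"
      by (simp only: z(1))
    then have "Abs_fps (\<lambda>n. \<tau> ((nc_var False * nc_var True) ^ n)) = moment_series \<rho>"
      by (rule fps_compose_cancel[OF _ z(2,3)])
    from arg_cong[OF this, of "\<lambda>f. f $ n"] show ?thesis by (simp add: moment_series_def)
  qed
  have "moment \<mu> 0 = 1" "moment \<nu> 0 = 1"
    using \<mu> \<nu> by (auto simp: moment_def compact_nonneg_distribution_def prob_space.prob_space)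
  then have "complex_of_real (moment (if i then \<nu> else \<mu>) 0) = 1" for i
    by simp
  from free_functional_exists[of "\<lambda>i k. complex_of_real (moment (if i then \<nu> else \<mu>) k)", OF this]
  obtain \<tau> :: "bool ncpoly \<Rightarrow> complex" where \<tau>: "unital_functional \<tau>" "free_variables \<tau>"
    "\<And>i k. \<tau> (nc_var i ^ k) = complex_of_real (moment (if i then \<nu> else \<mu>) k)"
    by blast
  have "(THE \<rho>'. compact_nonneg_distribution \<rho>' \<and> (\<exists>\<tau>. P \<tau> \<rho>')) = \<rho>"
  proof (rule the_equality)
    show "compact_nonneg_distribution \<rho> \<and> (\<exists>\<tau>. P \<tau> \<rho>)"
      using \<rho> \<tau> moments[OF \<tau>(1,2)] unfolding P_def by (intro conjI exI[of _ \<tau>]) simp_all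
  next
    fix \<rho>' assume \<rho>': "compact_nonneg_distribution \<rho>' \<and> (\<exists>\<tau>. P \<tau> \<rho>')"
    then obtain \<tau>' where \<tau>': "P \<tau>' \<rho>'" by blast
    have "complex_of_real (moment \<rho>' n) = complex_of_real (moment \<rho> n)" for n
      using \<tau>' moments[of \<tau>' n] unfolding P_def by metis
    then show "\<rho>' = \<rho>" using \<rho>' \<rho> by (intro compact_distribution_eqI) auto
  qed
  then show ?thesis unfolding free_mult_conv_def P_def Let_def .
qed

section \<open>The powers of the arcsine distribution\<close>

lemma raney_moment_coefficient:
  "((1 + fps_X) ^ N * (1 - of_nat r * fps_X) * inverse (1 - fps_X) :: complex fps) $ n =
     (\<Sum>j\<le>n. of_nat (N choose j) * ((if j = n then 1 else 0) - (if j < n then of_nat r - 1 else 0)))"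
proof -
  have inv: "inverse (1 - fps_X :: complex fps) = Abs_fps (\<lambda>n. 1)"
    using fps_inverse_gp'[where 'a = complex] by (metis fps_inverse_idempotent fps_nth_Abs_fps zero_neq_one)
  have "((1 - of_nat r * fps_X) * inverse (1 - fps_X) :: complex fps) $ k = (if k = 0 then 1 else 1 - of_nat r)" for k
    by (cases k) (simp_all add: inv left_diff_distrib mult.assoc fps_mult_of_nat_nth)
  moreover have "((1 + fps_X) ^ N :: complex fps) $ j = of_nat (N choose j)" for j
  proof -
    have "(fps_X + 1 :: complex fps) ^ N = (\<Sum>k\<le>N. of_nat (N choose k) * fps_X ^ k)"
      using binomial_ring[of "fps_X :: complex fps" 1 N] by simp
    then show ?thesis
      by (simp add: add.commute[of 1] fps_sum_nth fps_mult_of_nat_nth fps_X_power_nth if_distrib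
          binomial_eq_0 cong: if_cong)
  qed
  ultimately show ?thesis
    unfolding mult.assoc fps_mult_nth[of "(1 + fps_X) ^ N"] atLeast0AtMost
    by (intro sum.cong refl) auto
qed

text \<open>The measure with the explicit density, for \<open>r \<ge> 1\<close>.\<close>

definition raney_measure :: "nat \<Rightarrow> real measure" where
  "raney_measure r = density lborel (\<lambda>y. ennreal (raney.raney_density r y))"

context raney
begin

lemma moment_raney_measure: "moment (raney_measure r) n = raney_moment n"
proof -
  have "moment (raney_measure r) n = (\<integral>y. raney_density y *\<^sub>R y ^ n \<partial>lborel)"
    unfolding moment_def raney_measure_def
    by (rule integral_density) (auto simp: raney_density_nonneg)
  then show ?thesis using raney_density_moment(2)[of n] by simp
qed

lemma raney_measure_compact: "compact_nonneg_distribution (raney_measure r)"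
  unfolding compact_nonneg_distribution_def
proof (intro conjI exI)
  have int: "integrable lborel raney_density" and "integral\<^sup>L lborel raney_density = raney_moment 0"
    using raney_density_moment[of 0] by simp_all
  then have I: "integral\<^sup>L lborel raney_density = 1" by (simp add: raney_moment_def)
  have "emeasure (raney_measure r) (space (raney_measure r)) = (\<integral>\<^sup>+ y. ennreal (raney_density y) \<partial>lborel)"
    by (simp add: raney_measure_def emeasure_density)
  also have "\<dots> = 1"
    using nn_integral_eq_integral[OF int] raney_density_nonneg I by simp
  finally show "prob_space (raney_measure r)" by (rule prob_spaceI)
  show "sets (raney_measure r) = sets borel" by (simp add: raney_measure_def)
  show "AE x in raney_measure r. 0 \<le> x \<and> x \<le> spectral_max"
  proof -
    have "0 < ennreal (raney_density x) \<longrightarrow> 0 \<le> x \<and> x \<le> spectral_max" for x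
      by (simp add: raney_density_def)
    then have "AE x in lborel. 0 < ennreal (raney_density x) \<longrightarrow> 0 \<le> x \<and> x \<le> spectral_max"
      by (intro AE_I2)
    then show ?thesis unfolding raney_measure_def by (subst AE_density) simp_all
  qed
qed

lemma moment_series_raney_measure: "moment_series (raney_measure r) oo raney_inverse r = 1 + fps_X"
proof (rule raney_moment_series)
  fix n
  define N where "N = (r + 1) * n"
  define a where "a j = (if j = n then 1 else 0) - (if j < n then real r - 1 else 0)" for j
  have "raney_moment n = (\<Sum>j\<le>N. real (N choose j) * a j) / 2 ^ N"
    by (simp add: raney_moment_def N_def a_def sum_divide_distrib)
  also have "(\<Sum>j\<le>N. real (N choose j) * a j) = (\<Sum>j\<le>n. real (N choose j) * a j)"
    by (rule sum.mono_neutral_right) (auto simp: N_def a_def)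
  finally have "complex_of_real (raney_moment n) =
      (\<Sum>j\<le>n. of_nat (N choose j) * ((if j = n then 1 else 0) - (if j < n then of_nat r - 1 else 0))) / 2 ^ N"
    by (simp add: a_def if_distrib cong: if_cong)
  then show "moment_series (raney_measure r) $ n =
      ((1 + fps_X) ^ ((r + 1) * n) * (1 - of_nat r * fps_X) * inverse (1 - fps_X)) $ n / 2 ^ ((r + 1) * n)"
    unfolding raney_moment_coefficient by (simp add: moment_series_def moment_raney_measure N_def)
qed

lemma support_raney_measure: "measure_support (raney_measure r) = {0..spectral_max}"
proof (intro equalityI subsetI)
  fix x assume x: "x \<in> measure_support (raney_measure r)"
  show "x \<in> {0..spectral_max}"
  proof (rule ccontr)
    assume "x \<notin> {0..spectral_max}"
    then have "x \<in> - {0..spectral_max}" by simp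
    moreover have "open (- {0..spectral_max})" by (simp add: open_Compl)
    ultimately have "emeasure (raney_measure r) (- {0..spectral_max}) > 0"
      using x unfolding measure_support_def by blast
    moreover have "emeasure (raney_measure r) (- {0..spectral_max}) = (\<integral>\<^sup>+ y. 0 \<partial>lborel)"
    proof -
      have "ennreal (raney_density y) * indicator (- {0..spectral_max}) y = 0" for y
        by (simp add: raney_density_def)
      then show ?thesis unfolding raney_measure_def by (simp add: emeasure_density del: mult_eq_0_iff)
    qed
    ultimately show False by simp
  qed
next
  fix x assume x: "x \<in> {0..spectral_max}"
  show "x \<in> measure_support (raney_measure r)"
    unfolding measure_support_def
  proof (intro CollectI allI impI)
    fix U :: "real set" assume U: "open U" "x \<in> U"
    have "x \<in> closure {0<..<spectral_max}" using x spectral_max_pos by simp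
    then have "U \<inter> {0<..<spectral_max} \<noteq> {}"
      using U by (metis closure_iff_nhds_not_empty disjoint_iff open_subset subset_refl)
    moreover have open': "open (U \<inter> {0<..<spectral_max})" using U by auto
    ultimately have neg: "\<not> negligible (U \<inter> {0<..<spectral_max})" by (intro open_not_negligible)
    show "emeasure (raney_measure r) U > 0"
    proof (rule ccontr)
      assume "\<not> emeasure (raney_measure r) U > 0"
      then have "(\<integral>\<^sup>+ y. ennreal (raney_density y) * indicator U y \<partial>lborel) = 0"
        using U by (simp add: raney_measure_def emeasure_density)
      then have "AE y in lborel. ennreal (raney_density y) * indicator U y = 0"
        using U by (subst (asm) nn_integral_0_iff_AE) auto
      then have "AE y in lborel. y \<notin> U \<inter> {0<..<spectral_max}"
      proof eventually_elim
        case (elim y)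
        show ?case
        proof
          assume "y \<in> U \<inter> {0<..<spectral_max}"
          then have "raney_density y > 0" "y \<in> U"
            using spectral_density_pos angle[of y] by (auto simp: raney_density_def)
          then show False using elim by simp
        qed
      qed
      then have "U \<inter> {0<..<spectral_max} \<in> null_sets lborel"
        using open' by (subst (asm) AE_iff_null_sets[symmetric]) auto
      then show False using neg by (simp add: negligible_iff_null_sets null_sets_completionI)
    qed
  qed
qed

end

lemma arcsine_raney_measure: "arcsine_distribution = raney_measure (Suc 0)"
proof -
  interpret raney "Suc 0" by standard simp
  have max: "spectral_max = 1" by (simp add: spectral_max_def)
  have "indicator {0<..<1} y * (1 / (pi * sqrt (y * (1 - y)))) = raney_density y" for y
  proof (cases "y \<in> {0<..<1}")
    case True
    define \<phi> where "\<phi> = angle y"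
    have \<phi>: "0 < \<phi>" "\<phi> < angle_max" "spectral_var \<phi> = y" using angle[of y] True by (auto simp: \<phi>_def max)
    have s: "sin \<phi> > 0" "sin (2 * \<phi>) > 0" using sin_pos[OF \<phi>(1,2)] by simp_all
    then have c: "cos \<phi> > 0" by (simp add: sin_double zero_less_mult_iff)
    have y: "y = (cos \<phi>)\<^sup>2"
      using \<phi>(3) s c by (simp add: spectral_var_def sin_double power2_eq_square)
    then have "y * (1 - y) = (cos \<phi> * sin \<phi>)\<^sup>2"
      by (simp add: power_mult_distrib sin_squared_eq)
    then have "sqrt (y * (1 - y)) = cos \<phi> * sin \<phi>" using s c by simp
    moreover have "spectral_density \<phi> = 1 / (pi * (cos \<phi> * sin \<phi>))"
      using s c by (simp add: spectral_density_def sin_double power2_eq_square)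
    ultimately show ?thesis using True by (simp add: raney_density_def max \<phi>_def)
  next
    case False
    then show ?thesis by (auto simp: raney_density_def max)
  qed
  then show ?thesis by (simp add: arcsine_distribution_def raney_measure_def)
qed

lemma point_mass_one:
  "compact_nonneg_distribution (return borel 1)" "moment_series (return borel 1) oo raney_inverse 0 = 1 + fps_X"
proof -
  show "compact_nonneg_distribution (return borel 1)"
    unfolding compact_nonneg_distribution_def
    by (auto simp: prob_space_return AE_return intro!: exI[of _ 1])
  show "moment_series (return borel 1) oo raney_inverse 0 = 1 + fps_X"
  proof (rule raney_moment_series)
    fix n
    have "moment (return borel 1) n = 1" by (simp add: moment_def integral_return)
    moreover have "(\<Sum>j\<le>n. of_nat (n choose j) * ((if j = n then 1 else 0) - (if j < n then of_nat 0 - 1 else 0)))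
        = (\<Sum>j\<le>n. of_nat (n choose j) :: complex)"
      by (intro sum.cong refl) auto
    moreover have "(\<Sum>j\<le>n. of_nat (n choose j) :: complex) = 2 ^ n"
      using choose_row_sum[of n] by (metis of_nat_numeral of_nat_power of_nat_sum)
    ultimately show "moment_series (return borel 1) $ n =
        ((1 + fps_X) ^ ((0 + 1) * n) * (1 - of_nat 0 * fps_X) * inverse (1 - fps_X)) $ n / 2 ^ ((0 + 1) * n)"
      unfolding raney_moment_coefficient by (simp add: moment_series_def)
  qed
qed

text \<open>
  The induction starts at \<open>r = 0\<close> with the point mass at \<open>1\<close>, which has no density but has the inverse
  \<open>t / (1 + t)\<close>.
\<close>

lemma arcsine_power:
  "compact_nonneg_distribution (free_mult_conv_power arcsine_distribution r)"
  "moment_series (free_mult_conv_power arcsine_distribution r) oo raney_inverse r = 1 + fps_X"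
  "r \<ge> 1 \<Longrightarrow> free_mult_conv_power arcsine_distribution r = raney_measure r"
proof (induction r)
  case 0
  {
    case 1 show ?case using point_mass_one(1) by simp
  next
    case 2 show ?case using point_mass_one(2) by simp
  next
    case 3 then show ?case by simp
  }
next
  case (Suc r)
  interpret one: raney "Suc 0" by standard simp
  interpret S: raney "Suc r" by standard simp
  have eq: "free_mult_conv_power arcsine_distribution (Suc r) = raney_measure (Suc r)"
    unfolding free_mult_conv_power.simps arcsine_raney_measure
    by (rule free_mult_conv_eqI[OF Suc.IH(1)[unfolded arcsine_raney_measure] one.raney_measure_compact
          S.raney_measure_compact Suc.IH(2)[unfolded arcsine_raney_measure] raney_inverse_nth_0
          one.moment_series_raney_measure raney_inverse_nth_0 S.moment_series_raney_measure
          raney_inverse_nth_0 raney_inverse_nth_1 raney_inverse_Suc[unfolded One_nat_def]])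
  {
    case 1 show ?case unfolding eq by (rule S.raney_measure_compact)
  next
    case 2 show ?case unfolding eq by (rule S.moment_series_raney_measure)
  next
    case 3 show ?case by (rule eq)
  }
qed

theorem theorem3p2:
  fixes r :: nat and \<mu> :: "real measure" and b :: real and x d :: "real \<Rightarrow> real"
  assumes "r \<ge> 1"
  defines "\<mu> \<equiv> free_mult_conv_power arcsine_distribution r"
  defines "b \<equiv> (real r + 1) ^ (r + 1) / (2 ^ (r + 1) * real r ^ r)"
  defines "x \<equiv> (\<lambda>\<phi>. sin ((real r + 1) * \<phi>) ^ (r + 1) / (2 ^ (r + 1) * sin \<phi> * sin (real r * \<phi>) ^ r))"
  defines "d \<equiv> (\<lambda>\<phi>. 2 ^ (r + 2) * (sin \<phi>)\<^sup>2 * sin (real r * \<phi>) ^ (r + 1) /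
             (pi * sin ((real r + 1) * \<phi>) ^ r *
               (4 * (sin \<phi>)\<^sup>2 * (sin (real r * \<phi>))\<^sup>2 + (sin ((real r - 1) * \<phi>))\<^sup>2)))"
  shows "measure_support \<mu> = {0..b} \<and>
         bij_betw x {0<..<pi / (real r + 1)} {0<..<b} \<and>
         (\<exists>f \<in> borel_measurable borel.
            (\<forall>\<phi> \<in> {0<..<pi / (real r + 1)}. f (x \<phi>) = d \<phi>) \<and>
            (\<forall>y. y \<notin> {0<..<b} \<longrightarrow> f y = 0) \<and>
            \<mu> = density lborel (\<lambda>y. ennreal (f y)))"
proof -
  interpret raney r by standard (fact assms(1))
  have \<mu>: "\<mu> = raney_measure r" unfolding \<mu>_def by (rule arcsine_power(3)[OF assms(1)])
  have b: "b = spectral_max" by (simp only: b_def spectral_max_def)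
  have x: "x = spectral_var" by (simp only: x_def spectral_var_def[abs_def])
  have d: "d = spectral_density" by (simp only: d_def spectral_density_def[abs_def])
  have E: "pi / (real r + 1) = angle_max" by (simp only: angle_max_def)
  have "raney_density (spectral_var \<phi>) = spectral_density \<phi>" if "\<phi> \<in> {0<..<angle_max}" for \<phi>
    using that spectral_var_range[of \<phi>] angle_spectral_var[of \<phi>] by (simp add: raney_density_def)
  then show ?thesis
    unfolding \<mu> b x d E
    using support_raney_measure spectral_var_bij raney_density_measurable
    by (intro conjI bexI[of _ raney_density]) (auto simp: raney_density_def raney_measure_def)
qed

end
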